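(* Let $q$ be a permutation (a pattern), and let $E(q)\subseteq\{l,r,m,f,t\}^*$ be the language of all $it$-codewords whose encoded permutation avoids $q$. Then $E(q)$ is accepted by a linear-bounded automaton in polynomial time (i.e. there is a linear-bounded automaton accepting exactly $E(q)$ and running in a number of steps bounded by a polynomial in the length $|w|$ of the input $w$).
   Context: Permutations and patterns. A permutation is a finite ordered list of distinct real numbers. Two permutations $p_1\ldots p_n$ and $q_1\ldots q_n$ of the same length are order isomorphic if $p_i<p_j\iff q_i<q_j$ for all $1\le i<j\le n$. A permutation $p_1\ldots p_n$ contains a pattern $q=q_1\ldots q_k$ if $k\le n$ and some subsequence $p_{i_1}\ldots p_{i_k}$ ($i_1<\cdots<i_k$) is order isomorphic to $q$; otherwise $p$ avoids $q$. $it$-encoding ("insert and translate"). A codeword is a string $w$ over the alphabet $\{l,r,m,f,t\}$ such that (1) for each occurrence in $w$ of a letter $x\in\{l,r,m,f\}$, the number of letters $t$ immediately preceding $x$ (the maximal run of $t$'s just before $x$) is at most $k$, where $k$ is the number of $m$'s minus the number of $f$'s occurring in $w$ to the left of $x$ (in particular $k\ge 0$); (2) $w$ ends with an $f$; and (3) the number of $f$'s in $w$ is one more than the number of $m$'s, i.e. all slots are filled at the end of the procedure below. A codeword represents the permutation $p$ of $\{1,\ldots,n\}$ ($n$ = number of non-$t$ letters of $w$) obtained as follows. Start with $p=\diamond$ (a single open slot), $i=1$, next slot $=1$ (slots $\diamond$ are numbered from left to right). Read the letters of $w$ from left to right: - on $t$: increase the next slot by $1$; - on $l$: replace the next slot by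 $i\,\diamond$; - on $r$: replace the next slot by $\diamond\, i$; - on $m$: replace the next slot by $\diamond\, i\,\diamond$; - on $f$: replace the next slot by $i$; after each of $l,r,m,f$, increase $i$ by $1$ and reset the next slot to $1$. $E$ denotes the set of all codewords, and $E(q)\subseteq E$ the set of codewords representing permutations that avoid $q$. A linear-bounded automaton is a (possibly nondeterministic) Turing machine, with a finite tape alphabet, whose computation on an input $w$ uses only the tape squares on which $w$ is written (up to end-markers, or at most one additional square). *)

theory Defs
  imports "HOL-Computational_Algebra.Polynomial" "HOL-Library.Sublist"
begin

section \<open>Permutations and patterns\<close>

text \<open>
  A permutation is a list of pairwise distinct elements of a linear order. The two lists may
  have different element types, so that a list of naturals can be compared with a real pattern.
\<close>

definition order_isomorphic :: "'a::linorder list \<Rightarrow> 'b::linorder list \<Rightarrow> bool" where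
  "order_isomorphic p q \<longleftrightarrow>
     length p = length q \<and> (\<forall>i j. i < j \<and> j < length p \<longrightarrow> (p ! i < p ! j \<longleftrightarrow> q ! i < q ! j))"

definition contains_pattern :: "'a::linorder list \<Rightarrow> 'b::linorder list \<Rightarrow> bool" where
  "contains_pattern p q \<longleftrightarrow> (\<exists>s. subseq s p \<and> order_isomorphic s q)"

abbreviation avoids_pattern :: "'a::linorder list \<Rightarrow> 'b::linorder list \<Rightarrow> bool" where
  "avoids_pattern p q \<equiv> \<not> contains_pattern p q"


section \<open>The insert-and-translate encoding\<close>

datatype it_letter = It_l | It_r | It_m | It_f | It_t

definition it_codewords :: "it_letter list set" where
  "it_codewords = {w.
     (\<forall>i < length w. w ! i \<noteq> It_t \<longrightarrow>
        int (length (takeWhile (\<lambda>x. x = It_t) (rev (take i w))))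
          \<le> int (count_list (take i w) It_m) - int (count_list (take i w) It_f)) \<and>
     w \<noteq> [] \<and> last w = It_f \<and>
     count_list w It_f = count_list w It_m + 1}"

datatype entry = Slot | Num nat

text \<open>
  Slots are numbered from 1. If there is no slot number \<open>j\<close>, the list is left unchanged;
  this never happens while reading a codeword.
\<close>

fun replace_slot :: "nat \<Rightarrow> entry list \<Rightarrow> entry list \<Rightarrow> entry list" where
  "replace_slot j us [] = []"
| "replace_slot j us (Num a # xs) = Num a # replace_slot j us xs"
| "replace_slot j us (Slot # xs) =
     (if j \<le> 1 then us @ xs else Slot # replace_slot (j - 1) us xs)"

text \<open>The state is (current list, next number \<open>i\<close> to insert, next slot \<open>j\<close>).\<close>

fun it_step :: "it_letter \<Rightarrow> entry list \<times> nat \<times> nat \<Rightarrow> entry list \<times> nat \<times> nat" where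
  "it_step It_t (xs, i, j) = (xs, i, j + 1)"
| "it_step It_l (xs, i, j) = (replace_slot j [Num i, Slot] xs, i + 1, 1)"
| "it_step It_r (xs, i, j) = (replace_slot j [Slot, Num i] xs, i + 1, 1)"
| "it_step It_m (xs, i, j) = (replace_slot j [Slot, Num i, Slot] xs, i + 1, 1)"
| "it_step It_f (xs, i, j) = (replace_slot j [Num i] xs, i + 1, 1)"

definition represents :: "it_letter list \<Rightarrow> nat list \<Rightarrow> bool" where
  "represents w p \<longleftrightarrow> fst (fold it_step w ([Slot], 1, 1)) = map Num p"

definition it_avoiders :: "'b::linorder list \<Rightarrow> it_letter list set" where
  "it_avoiders q = {w \<in> it_codewords. \<exists>p. represents w p \<and> avoids_pattern p q}"


section \<open>Linear-bounded automata\<close>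

text \<open>
  A (nondeterministic) machine works on a tape that consists of the input word between two
  end-markers. The tape alphabet contains the input alphabet, which is the type \<open>'a\<close>.
  A transition \<open>(s, a, s', b, d)\<close> is: in state \<open>s\<close> reading \<open>a\<close>, go to state \<open>s'\<close>, write \<open>b\<close>
  and move the head in direction \<open>d\<close>.
\<close>

datatype ('a, 'g) tape_symbol = Left_End | Right_End | Input 'a | Work 'g

datatype direction = Go_Left | Stay | Go_Right

record ('s, 'g, 'a) lba =
  lba_states :: "'s set"
  lba_work :: "'g set"
  lba_start :: 's
  lba_accept :: "'s set"
  lba_trans :: "('s \<times> ('a, 'g) tape_symbol \<times> 's \<times> ('a, 'g) tape_symbol \<times> direction) set"

definition lba_tape_alphabet :: "('s, 'g, 'a) lba \<Rightarrow> ('a, 'g) tape_symbol set" where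
  "lba_tape_alphabet M = {Left_End, Right_End} \<union> range Input \<union> Work ` lba_work M"

text \<open>
  Accepting states are halting. The end-markers are neither created, nor overwritten, nor crossed,
  so the head never leaves the input squares and the two end-markers.
\<close>

definition is_lba :: "('s, 'g, 'a) lba \<Rightarrow> bool" where
  "is_lba M \<longleftrightarrow>
     finite (lba_states M) \<and> finite (lba_tape_alphabet M) \<and>
     lba_start M \<in> lba_states M \<and> lba_accept M \<subseteq> lba_states M \<and>
     lba_trans M \<subseteq> (lba_states M - lba_accept M) \<times> lba_tape_alphabet M \<times>
                    lba_states M \<times> lba_tape_alphabet M \<times> UNIV \<and>
     (\<forall>(s, a, s', b, d) \<in> lba_trans M.
        (a = Left_End \<longleftrightarrow> b = Left_End) \<and> (a = Right_End \<longleftrightarrow> b = Right_End) \<and>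
        (a = Left_End \<longrightarrow> d \<noteq> Go_Left) \<and> (a = Right_End \<longrightarrow> d \<noteq> Go_Right))"

fun move_head :: "direction \<Rightarrow> nat \<Rightarrow> nat" where
  "move_head Go_Left i = i - 1"
| "move_head Stay i = i"
| "move_head Go_Right i = i + 1"

text \<open>
  A configuration is (state, head position, tape). The left end-marker is at position 0, and
  the head starts at position 1.
\<close>

type_synonym ('s, 'g, 'a) config = "'s \<times> nat \<times> ('a, 'g) tape_symbol list"

definition lba_init :: "('s, 'g, 'a) lba \<Rightarrow> 'a list \<Rightarrow> ('s, 'g, 'a) config" where
  "lba_init M w = (lba_start M, 1, [Left_End] @ map Input w @ [Right_End])"

inductive lba_step ::
  "('s, 'g, 'a) lba \<Rightarrow> ('s, 'g, 'a) config \<Rightarrow> ('s, 'g, 'a) config \<Rightarrow> bool" for M where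
  "i < length xs \<Longrightarrow> (s, xs ! i, s', b, d) \<in> lba_trans M \<Longrightarrow>
     lba_step M (s, i, xs) (s', move_head d i, xs[i := b])"

definition lba_language :: "('s, 'g, 'a) lba \<Rightarrow> 'a list set" where
  "lba_language M =
     {w. \<exists>s i xs. (lba_step M)\<^sup>*\<^sup>* (lba_init M w) (s, i, xs) \<and> s \<in> lba_accept M}"

text \<open>
  The time bound concerns every computation on \<open>w\<close>, accepting or not; in particular all of
  them halt.
\<close>

definition lba_time_bounded :: "('s, 'g, 'a) lba \<Rightarrow> 'a list \<Rightarrow> nat \<Rightarrow> bool" where
  "lba_time_bounded M w N \<longleftrightarrow> (\<forall>n c. (lba_step M ^^ n) (lba_init M w) c \<longrightarrow> n \<le> N)"

definition polynomial_time_lba :: "('s, 'g, 'a) lba \<Rightarrow> bool" where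
  "polynomial_time_lba M \<longleftrightarrow>
     (\<exists>P :: nat poly. \<forall>w. lba_time_bounded M w (poly P (length w)))"

end

theory Submission
  imports Defs "HOL-Library.Countable" "HOL-Library.Multiset"
begin

text \<open>
  Decoding a codeword of length \<open>n\<close> needs only the current list of numbers and slots, and this list
  always has at most \<open>n\<close> entries: a number in it was inserted by a letter already read, and every
  slot must be closed by an \<open>f\<close> still to come. So the list can be kept on the \<open>n\<close> tape
  squares, one entry per square; a list that grows beyond this cannot come from a codeword. What does
  not fit into a finite alphabet are the numbers themselves, and avoiding \<open>q\<close> does not ask for
  them. It asks that no choice of \<open>k\<close> letters, \<open>k\<close> being the length of \<open>q\<close>, inserts a
  subsequence order isomorphic to \<open>q\<close>. For one choice it suffices to remember of a chosen number
  its rank in time among the chosen ones, which is at most \<open>k\<close>, and \<open>0\<close> of any other number.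
  Later insertions are larger, so at the end the nonzero ranks, read from left to right, are order
  isomorphic to the chosen subsequence, and the finite control compares them with \<open>q\<close>
  (\<open>simulate_iff_codeword\<close>).

  There are at most \<open>n\<close> to the power \<open>k\<close> choices, so they can be tried one after another in
  polynomial time. This is done one letter at a time: the words all of whose \<open>n\<close> markings at a
  single position lie in a given language are decided by a loop around a machine for that language
  (\<open>sweep_decidable_for_all_marks\<close>). For positive \<open>k\<close>, nesting \<open>k\<close> loops marks all
  nonempty sets of at most \<open>k\<close> letters. Those with fewer than \<open>k\<close> letters do no harm, since their
  rank sequence has the wrong length (\<open>it_avoiders_iff\<close>).

  Both the decoder and the loop are easy to describe as repeated passes over the tape in which a
  finite-state transducer rewrites every square from left to right. Such a sweeping machine composes
  well, because a machine started by another one always finds the head at the left end. A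
  deterministic linear-bounded automaton carries out a pass and walks back in a linear number of steps
  (\<open>lba_if_sweep_decidable\<close>).
\<close>

section \<open>Sweeping machines\<close>

datatype 's verdict = Accept | Reject | Continue 's

text \<open>
  The input word is first turned into tape squares by \<open>cell\<close>. A pass applies the transducer
  \<open>act\<close> to all squares, where \<open>None\<close> means that the machine is stuck and rejects; the state at
  the right end decides by \<open>verdict\<close> whether another pass follows.
\<close>

record ('s, 'g, 'a) sweeper =
  start :: 's
  cell :: "'a \<Rightarrow> 'g"
  act :: "'s \<Rightarrow> 'g \<Rightarrow> ('s \<times> 'g) option"
  verdict :: "'s \<Rightarrow> 's verdict"

fun sweep :: "('s \<Rightarrow> 'g \<Rightarrow> ('s \<times> 'g) option) \<Rightarrow> 's \<Rightarrow> 'g list \<Rightarrow> ('s \<times> 'g list) option" where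
  "sweep f c [] = Some (c, [])"
| "sweep f c (g # gs) =
     (case f c g of None \<Rightarrow> None
      | Some (c', g') \<Rightarrow> map_option (apsnd ((#) g')) (sweep f c' gs))"

lemma sweep_length: "sweep f c us = Some (c', us') \<Longrightarrow> length us' = length us"
  by (induction us arbitrary: c us') (auto split: option.splits)

text \<open>
  The last argument counts the passes. A big-step relation is used because it composes: the run of an
  inner machine becomes, by rule induction, an initial part of the run of a machine around it.
\<close>

inductive outcome :: "('s, 'g, 'a) sweeper \<Rightarrow> 's \<Rightarrow> 'g list \<Rightarrow> bool \<Rightarrow> nat \<Rightarrow> bool" for M where
  stuck: "sweep (act M) c u = None \<Longrightarrow> outcome M c u False 1"
| accept: "sweep (act M) c u = Some (c', u') \<Longrightarrow> verdict M c' = Accept \<Longrightarrow> outcome M c u True 1"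
| reject: "sweep (act M) c u = Some (c', u') \<Longrightarrow> verdict M c' = Reject \<Longrightarrow> outcome M c u False 1"
| continue: "sweep (act M) c u = Some (c', u') \<Longrightarrow> verdict M c' = Continue c'' \<Longrightarrow>
     outcome M c'' u' b n \<Longrightarrow> outcome M c u b (Suc n)"

text \<open>
  States and squares are confined to sets instead of finite types, since for the decoder the bound
  depends on the pattern.
\<close>

definition finite_sweeper :: "('s, 'g, 'a) sweeper \<Rightarrow> 's set \<Rightarrow> 'g set \<Rightarrow> bool" where
  "finite_sweeper M S G \<longleftrightarrow>
     finite S \<and> finite G \<and> start M \<in> S \<and> range (cell M) \<subseteq> G \<and>
     (\<forall>c\<in>S. \<forall>g\<in>G. \<forall>c' g'. act M c g = Some (c', g') \<longrightarrow> c' \<in> S \<and> g' \<in> G) \<and>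
     (\<forall>c\<in>S. \<forall>c'. verdict M c = Continue c' \<longrightarrow> c' \<in> S)"

lemma finite_sweeperD:
  assumes "finite_sweeper M S G"
  shows "finite S" "finite G" "start M \<in> S" "cell M a \<in> G"
    and "act M c g = Some (c', g') \<Longrightarrow> c \<in> S \<Longrightarrow> g \<in> G \<Longrightarrow> c' \<in> S \<and> g' \<in> G"
    and "verdict M c = Continue c' \<Longrightarrow> c \<in> S \<Longrightarrow> c' \<in> S"
  using assms unfolding finite_sweeper_def by blast+

definition decides_within :: "('s, 'g, 'a) sweeper \<Rightarrow> 'a list set \<Rightarrow> nat poly \<Rightarrow> bool" where
  "decides_within M L P \<longleftrightarrow>
     (\<forall>w. \<exists>n \<le> poly P (length w). outcome M (start M) (map (cell M) w) (w \<in> L) n)"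

text \<open>
  Fixing \<open>nat\<close> for states and squares makes this a predicate on languages over which one can do
  induction, although every loop around a machine changes the types of its states and squares.
\<close>

definition sweep_decidable :: "'a list set \<Rightarrow> bool" where
  "sweep_decidable L \<longleftrightarrow>
     (\<exists>(M :: (nat, nat, 'a) sweeper) S G P. finite_sweeper M S G \<and> decides_within M L P)"

definition recode :: "('s::countable, 'g::countable, 'a) sweeper \<Rightarrow> (nat, nat, 'a) sweeper" where
  "recode M =
     \<lparr> start = to_nat (start M),
       cell = (\<lambda>a. to_nat (cell M a)),
       act = (\<lambda>c g. map_option (map_prod to_nat to_nat) (act M (from_nat c) (from_nat g))),
       verdict = (\<lambda>c. map_verdict to_nat (verdict M (from_nat c))) \<rparr>"

lemma map_verdict_eq_Continue:
  "map_verdict f v = Continue c' \<longleftrightarrow> (\<exists>c. v = Continue c \<and> c' = f c)"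
  by (cases v) auto

lemma sweep_recode:
  "sweep (act (recode M)) (to_nat c) (map to_nat u) =
     map_option (map_prod to_nat (map to_nat)) (sweep (act M) c u)"
proof (induction u arbitrary: c)
  case (Cons g u)
  show ?case
  proof (cases "act M c g")
    case None
    then show ?thesis by (simp add: recode_def)
  next
    case (Some cg)
    then obtain c' g' where cg: "act M c g = Some (c', g')" by (cases cg) auto
    then have "sweep (act (recode M)) (to_nat c) (map to_nat (g # u)) =
      map_option (apsnd ((#) (to_nat g'))) (sweep (act (recode M)) (to_nat c') (map to_nat u))"
      by (simp add: recode_def)
    then show ?thesis
      unfolding Cons.IH using cg by (cases "sweep (act M) c' u") auto
  qed
qed simp

lemma outcome_recode:
  "outcome M c u b n \<Longrightarrow> outcome (recode M) (to_nat c) (map to_nat u) b n"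
proof (induction rule: outcome.induct)
  case (stuck c u)
  then show ?case by (intro outcome.stuck) (simp add: sweep_recode)
next
  case (accept c u c' u')
  then show ?case
    by (intro outcome.accept[where c' = "to_nat c'"]) (auto simp: sweep_recode, simp add: recode_def)
next
  case (reject c u c' u')
  then show ?case
    by (intro outcome.reject[where c' = "to_nat c'"]) (auto simp: sweep_recode, simp add: recode_def)
next
  case (continue c u c' u' c'' b n)
  then show ?case
    by (intro outcome.continue[where c' = "to_nat c'" and c'' = "to_nat c''"])
      (auto simp: sweep_recode, simp add: recode_def)
qed

text \<open>
  Renaming states and squares injectively changes nothing, so machines may be described with any
  countable types.
\<close>

lemma sweep_decidableI:
  fixes M :: "('s::countable, 'g::countable, 'a) sweeper"
  assumes fin: "finite_sweeper M S G" and dec: "decides_within M L P"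
  shows "sweep_decidable L"
proof -
  note D = finite_sweeperD[OF fin]
  have "finite_sweeper (recode M) (to_nat ` S) (to_nat ` G)"
    unfolding finite_sweeper_def
  proof (intro conjI ballI allI impI)
    show "finite (to_nat ` S)" "finite (to_nat ` G)" "start (recode M) \<in> to_nat ` S"
      "range (cell (recode M)) \<subseteq> to_nat ` G"
      using D(1-4) by (auto simp: recode_def)
  next
    fix c c' assume "c \<in> to_nat ` S" "verdict (recode M) c = Continue c'"
    then show "c' \<in> to_nat ` S"
      using D(6) by (auto simp: recode_def map_verdict_eq_Continue)
  next
    fix c g c' g' assume "c \<in> to_nat ` S" "g \<in> to_nat ` G" "act (recode M) c g = Some (c', g')"
    then show "c' \<in> to_nat ` S" "g' \<in> to_nat ` G"
      using D(5) by (auto simp: recode_def)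
  qed
  moreover have "decides_within (recode M) L P"
    unfolding decides_within_def
  proof
    fix w
    obtain n where n: "n \<le> poly P (length w)" "outcome M (start M) (map (cell M) w) (w \<in> L) n"
      using dec unfolding decides_within_def by blast
    have "outcome (recode M) (start (recode M)) (map (cell (recode M)) w) (w \<in> L) n"
      using outcome_recode[OF n(2)] by (simp add: recode_def comp_def)
    with n(1) show "\<exists>n\<le>poly P (length w).
        outcome (recode M) (start (recode M)) (map (cell (recode M)) w) (w \<in> L) n" by blast
  qed
  ultimately show ?thesis unfolding sweep_decidable_def by blast
qed

lemma sweep_decidable_vimage:
  assumes "sweep_decidable L"
  shows "sweep_decidable {w. map h w \<in> L}"
proof -
  obtain M :: "(nat, nat, 'a) sweeper" and S G P
    where M: "finite_sweeper M S G" "decides_within M L P"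
    using assms unfolding sweep_decidable_def by blast
  define M' :: "(nat, nat, 'b) sweeper" where
    "M' = \<lparr> start = start M, cell = cell M \<circ> h, act = act M, verdict = verdict M \<rparr>"
  have *: "outcome M' c u b n" if "outcome M c u b n" for c u b n
    using that
  proof induction
    case stuck
    then show ?case by (intro outcome.stuck) (simp add: M'_def)
  next
    case accept
    then show ?case by (intro outcome.accept) (auto simp: M'_def)
  next
    case reject
    then show ?case by (intro outcome.reject) (auto simp: M'_def)
  next
    case continue
    then show ?case by (intro outcome.continue) (auto simp: M'_def)
  qed
  have "finite_sweeper M' S G" 
    using finite_sweeperD[OF M(1)] unfolding finite_sweeper_def M'_def by auto
  moreover have "decides_within M' {w. map h w \<in> L} P"
    unfolding decides_within_def
  proof
    fix w
    obtain n where "n \<le> poly P (length w)"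
      "outcome M (start M) (map (cell M) (map h w)) (map h w \<in> L) n"
      using M(2) unfolding decides_within_def by (metis length_map)
    then show "\<exists>n\<le>poly P (length w).
        outcome M' (start M') (map (cell M') w) (w \<in> {w. map h w \<in> L}) n"
      using *[of "start M" "map (cell M) (map h w)"] by (intro exI[of _ n]) (simp add: M'_def)
  qed
  ultimately show ?thesis unfolding sweep_decidable_def by blast
qed

section \<open>Linear-bounded automata perform sweeps\<close>

text \<open>
  \<open>Forward\<close> carries out a pass, \<open>Backward\<close> brings the head back to the left end with the
  state for the next pass, and \<open>Halted\<close> is the accepting state.
\<close>

datatype phase = Forward nat | Backward nat | Halted

instance phase :: countable
  by countable_datatype

text \<open>
  A square that has not been visited yet still holds the input letter, which is read as the square
  that the sweeping machine would start with. The value on end-markers is arbitrary.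
\<close>

fun content :: "(nat, nat, 'a) sweeper \<Rightarrow> ('a, nat) tape_symbol \<Rightarrow> nat" where
  "content M (Input a) = cell M a"
| "content M (Work g) = g"
| "content M _ = 0"

definition squares :: "nat set \<Rightarrow> ('a, nat) tape_symbol set" where
  "squares G = range Input \<union> Work ` G"

text \<open>
  Rejection, whether by \<open>act\<close> or by \<open>verdict\<close>, is the absence of a transition.
\<close>

definition machine_trans :: "(nat, nat, 'a) sweeper \<Rightarrow> nat set \<Rightarrow> nat set \<Rightarrow>
    (phase \<times> ('a, nat) tape_symbol \<times> phase \<times> ('a, nat) tape_symbol \<times> direction) set" where
  "machine_trans M S G =
     {(Forward c, x, Forward c', Work g', Go_Right) | c x c' g'.
        c \<in> S \<and> x \<in> squares G \<and> act M c (content M x) = Some (c', g')} \<union>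
     {(Forward c, Right_End, Halted, Right_End, Stay) | c. c \<in> S \<and> verdict M c = Accept} \<union>
     {(Forward c, Right_End, Backward c', Right_End, Go_Left) | c c'. c \<in> S \<and> verdict M c = Continue c'} \<union>
     {(Backward c, x, Backward c, x, Go_Left) | c x. c \<in> S \<and> x \<in> squares G} \<union>
     {(Backward c, Left_End, Forward c, Left_End, Go_Right) | c. c \<in> S}"

definition sweeper_lba :: "(nat, nat, 'a) sweeper \<Rightarrow> nat set \<Rightarrow> nat set \<Rightarrow> (nat, nat, 'a) lba" where
  "sweeper_lba M S G = \<lparr>
     lba_states = to_nat ` (Forward ` S \<union> Backward ` S \<union> {Halted}),
     lba_work = G,
     lba_start = to_nat (Forward (start M)),
     lba_accept = {to_nat Halted},
     lba_trans = (\<lambda>(s, x, s', x', d). (to_nat s, x, to_nat s', x', d)) ` machine_trans M S G \<rparr>"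

lemma sweeper_lba_trans:
  "(s, x, s', x', d) \<in> lba_trans (sweeper_lba M S G) \<longleftrightarrow>
     (\<exists>p p'. s = to_nat p \<and> s' = to_nat p' \<and> (p, x, p', x', d) \<in> machine_trans M S G)"
  unfolding sweeper_lba_def by force

lemma squares_not_ends: "x \<in> squares G \<Longrightarrow> x \<noteq> Left_End \<and> x \<noteq> Right_End"
  by (auto simp: squares_def)

lemma is_lba_sweeper_lba:
  fixes M :: "(nat, nat, 'a::finite) sweeper"
  assumes "finite_sweeper M S G"
  shows "is_lba (sweeper_lba M S G)"
proof -
  note D = finite_sweeperD[OF assms]
  have content: "content M x \<in> G" if "x \<in> squares G" for x
    using that D(4) by (auto simp: squares_def)
  then have closed: "c' \<in> S \<and> g' \<in> G"
    if "act M c (content M x) = Some (c', g')" "c \<in> S" "x \<in> squares G" for c x c' g'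
    using that D(5) by blast
  let ?N = "sweeper_lba M S G"
  have alphabet: "squares G \<subseteq> lba_tape_alphabet ?N" "Left_End \<in> lba_tape_alphabet ?N"
    "Right_End \<in> lba_tape_alphabet ?N" "\<And>g. g \<in> G \<Longrightarrow> Work g \<in> lba_tape_alphabet ?N"
    by (auto simp: lba_tape_alphabet_def squares_def sweeper_lba_def)
  have *: "p \<in> Forward ` S \<union> Backward ` S \<and> p' \<in> Forward ` S \<union> Backward ` S \<union> {Halted} \<and>
      x \<in> lba_tape_alphabet ?N \<and> x' \<in> lba_tape_alphabet ?N \<and>
      (x = Left_End \<longleftrightarrow> x' = Left_End) \<and> (x = Right_End \<longleftrightarrow> x' = Right_End) \<and>
      (x = Left_End \<longrightarrow> d \<noteq> Go_Left) \<and> (x = Right_End \<longrightarrow> d \<noteq> Go_Right)"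
    if "(p, x, p', x', d) \<in> machine_trans M S G" for p x p' x' d
    using that unfolding machine_trans_def
    by (elim UnE CollectE exE conjE)
      (use alphabet in \<open>auto dest: closed D(6) squares_not_ends\<close>)
  have states: "lba_states ?N = to_nat ` (Forward ` S \<union> Backward ` S \<union> {Halted})"
    "lba_accept ?N = {to_nat Halted}"
    by (simp_all add: sweeper_lba_def)
  show ?thesis
    unfolding is_lba_def
  proof (intro conjI)
    show "finite (lba_states ?N)" "finite (lba_tape_alphabet ?N)"
      using D(1-3) by (auto simp: sweeper_lba_def lba_tape_alphabet_def)
    show "lba_start ?N \<in> lba_states ?N" "lba_accept ?N \<subseteq> lba_states ?N"
      using D(1-3) by (auto simp: sweeper_lba_def)
    show "lba_trans ?N \<subseteq> (lba_states ?N - lba_accept ?N) \<times> lba_tape_alphabet ?N \<times>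
        lba_states ?N \<times> lba_tape_alphabet ?N \<times> UNIV"
    proof
      fix t assume t: "t \<in> lba_trans ?N"
      obtain s x s' x' d where t': "t = (s, x, s', x', d)" by (cases t) auto
      with t obtain p p' where p: "s = to_nat p" "s' = to_nat p'"
        "(p, x, p', x', d) \<in> machine_trans M S G"
        by (auto simp: sweeper_lba_trans)
      from *[OF p(3)] show "t \<in> (lba_states ?N - lba_accept ?N) \<times> lba_tape_alphabet ?N \<times>
          lba_states ?N \<times> lba_tape_alphabet ?N \<times> UNIV"
        unfolding t' p states by auto
    qed
    show "\<forall>(s, x, s', x', d) \<in> lba_trans ?N.
        (x = Left_End \<longleftrightarrow> x' = Left_End) \<and> (x = Right_End \<longleftrightarrow> x' = Right_End) \<and>
        (x = Left_End \<longrightarrow> d \<noteq> Go_Left) \<and> (x = Right_End \<longrightarrow> d \<noteq> Go_Right)"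
      using * sweeper_lba_trans[of _ _ _ _ _ M S G] by blast
  qed
qed

text \<open>
  Determinism matters for the time bound, which concerns all computations: it is enough to follow a
  single one. For the same reason it decides acceptance.
\<close>

lemma machine_trans_functional:
  assumes "(p, x, p1, x1, d1) \<in> machine_trans M S G" "(p, x, p2, x2, d2) \<in> machine_trans M S G"
  shows "p1 = p2 \<and> x1 = x2 \<and> d1 = d2"
  using assms unfolding machine_trans_def squares_def by auto

lemma sweeper_lba_right_unique:
  assumes "lba_step (sweeper_lba M S G) k k1" "lba_step (sweeper_lba M S G) k k2"
  shows "k1 = k2"
proof -
  from assms(1) obtain i xs s s1 b1 d1 where 1: "k = (s, i, xs)" "k1 = (s1, move_head d1 i, xs[i := b1])"
    "(s, xs ! i, s1, b1, d1) \<in> lba_trans (sweeper_lba M S G)"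
    by (cases rule: lba_step.cases) auto
  from assms(2) 1(1) obtain s2 b2 d2 where 2: "k2 = (s2, move_head d2 i, xs[i := b2])"
    "(s, xs ! i, s2, b2, d2) \<in> lba_trans (sweeper_lba M S G)"
    by (cases rule: lba_step.cases) auto
  show ?thesis
    using 1 2 machine_trans_functional unfolding sweeper_lba_trans by (metis to_nat_split injD inj_to_nat)
qed

lemma lba_stepI:
  assumes "i < length xs" "(p, xs ! i, p', b, d) \<in> machine_trans M S G"
  shows "lba_step (sweeper_lba M S G) (to_nat p, i, xs) (to_nat p', move_head d i, xs[i := b])"
  using assms by (intro lba_step.intros) (auto simp: sweeper_lba_trans)

lemma lba_step_stuck:
  assumes "\<And>p' b d. (p, xs ! i, p', b, d) \<notin> machine_trans M S G"
  shows "\<not> lba_step (sweeper_lba M S G) (to_nat p, i, xs) k"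
proof
  assume "lba_step (sweeper_lba M S G) (to_nat p, i, xs) k"
  then show False
    using assms by (cases rule: lba_step.cases) (auto simp: sweeper_lba_trans)
qed

definition halting_run :: "('s, 'g, 'a) lba \<Rightarrow> ('s, 'g, 'a) config \<Rightarrow> bool \<Rightarrow> nat \<Rightarrow> bool" where
  "halting_run N k b T \<longleftrightarrow> (\<exists>m\<le>T. \<exists>k'. (lba_step N ^^ m) k k' \<and> (\<forall>v. \<not> lba_step N k' v) \<and>
     (fst k' \<in> lba_accept N \<longleftrightarrow> b))"

lemma halting_run_step:
  assumes "(lba_step N ^^ m) k k'" "halting_run N k' b T"
  shows "halting_run N k b (m + T)"
proof -
  from assms(2) obtain m' l where "m' \<le> T" "(lba_step N ^^ m') k' l"
    "\<forall>v. \<not> lba_step N l v" "fst l \<in> lba_accept N \<longleftrightarrow> b"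
    unfolding halting_run_def by blast
  then show ?thesis
    using assms(1) unfolding halting_run_def
    by (intro exI[of _ "m + m'"] exI[of _ l] conjI relpowp_trans) auto
qed

lemma halting_run_mono: "halting_run N k b T \<Longrightarrow> T \<le> T' \<Longrightarrow> halting_run N k b T'"
  unfolding halting_run_def by (meson order_trans)

lemma halting_run_stuck:
  assumes "\<And>k'. \<not> lba_step N k k'" "fst k \<in> lba_accept N \<longleftrightarrow> b"
  shows "halting_run N k b 0"
  using assms unfolding halting_run_def by (intro exI[of _ 0] exI[of _ k]) simp

text \<open>
  Every run of a deterministic relation is an initial part of the run that ends in a stuck
  configuration.
\<close>

lemma right_unique_relpowp:
  assumes unique: "\<And>x y z. R x y \<Longrightarrow> R x z \<Longrightarrow> y = z"
    and run: "(R ^^ m) x y" and stuck: "\<And>z. \<not> R y z" and run': "(R ^^ n) x z"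
  shows "n \<le> m \<and> (n = m \<longrightarrow> z = y) \<and> (n < m \<longrightarrow> (\<exists>v. R z v))"
  using run run'
proof (induction m arbitrary: x n)
  case 0
  have "n = 0"
  proof (rule ccontr)
    assume "n \<noteq> 0"
    then obtain n' where "(R ^^ Suc n') y z" using 0 by (cases n) auto
    then show False using stuck relpowp_Suc_D2 by metis
  qed
  then show ?case using 0 by auto
next
  case (Suc m)
  from Suc.prems(1) obtain x' where x': "R x x'" "(R ^^ m) x' y" using relpowp_Suc_D2 by metis
  show ?case
  proof (cases n)
    case 0
    then show ?thesis using Suc.prems(2) x'(1) by auto
  next
    case (Suc n')
    then obtain x'' where "R x x''" "(R ^^ n') x'' z" 
      using Suc.prems(2) relpowp_Suc_D2 by metis
    with unique x'(1) have "(R ^^ n') x' z" by metis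
    from Suc.IH[OF x'(2) this] Suc show ?thesis by auto
  qed
qed

lemma halting_run_language:
  assumes unique: "\<And>k k1 k2. lba_step N k k1 \<Longrightarrow> lba_step N k k2 \<Longrightarrow> k1 = k2"
    and accept: "\<And>k k'. lba_step N k k' \<Longrightarrow> fst k \<notin> lba_accept N"
    and run: "halting_run N (lba_init N w) b T"
  shows "lba_time_bounded N w T" and "w \<in> lba_language N \<longleftrightarrow> b"
proof -
  obtain m k where m: "m \<le> T" "(lba_step N ^^ m) (lba_init N w) k" "\<And>k'. \<not> lba_step N k k'"
    "fst k \<in> lba_accept N \<longleftrightarrow> b"
    using run unfolding halting_run_def by blast
  have final: "n \<le> m \<and> (n = m \<longrightarrow> z = k) \<and> (n < m \<longrightarrow> (\<exists>v. lba_step N z v))"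
    if "(lba_step N ^^ n) (lba_init N w) z" for n z
    by (rule right_unique_relpowp[OF _ m(2,3) that]) (rule unique)
  show "lba_time_bounded N w T"
    unfolding lba_time_bounded_def using final m(1) le_trans by blast
  have "b" if "w \<in> lba_language N"
  proof -
    from that obtain s i xs where "(lba_step N)\<^sup>*\<^sup>* (lba_init N w) (s, i, xs)" "s \<in> lba_accept N"
      unfolding lba_language_def by blast
    then obtain n where n: "(lba_step N ^^ n) (lba_init N w) (s, i, xs)" by (meson rtranclp_imp_relpowp)
    have "\<not> lba_step N (s, i, xs) v" for v using accept \<open>s \<in> lba_accept N\<close> by fastforce
    with final[OF n] have "(s, i, xs) = k" using le_neq_implies_less by blast
    then show b using m(4) \<open>s \<in> lba_accept N\<close> by auto
  qed
  moreover have "w \<in> lba_language N" if b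
    unfolding lba_language_def using that m(2,4) by (cases k) (auto dest: relpowp_imp_rtranclp)
  ultimately show "w \<in> lba_language N \<longleftrightarrow> b" by blast
qed

text \<open>
  The list \<open>as\<close> is the part of the tape to the left of the head, which the pass has already
  rewritten.
\<close>

lemma forward_pass:
  assumes fin: "finite_sweeper M S G"
  shows "\<lbrakk>c \<in> S; set bs \<subseteq> squares G; sweep (act M) c (map (content M) bs) = Some (c', gs)\<rbrakk> \<Longrightarrow>
      c' \<in> S \<and> set gs \<subseteq> G \<and>
      (lba_step (sweeper_lba M S G) ^^ length bs)
        (to_nat (Forward c), length as, as @ bs @ [Right_End])
        (to_nat (Forward c'), length as + length bs, as @ map Work gs @ [Right_End])"
    and "\<lbrakk>c \<in> S; set bs \<subseteq> squares G; sweep (act M) c (map (content M) bs) = None\<rbrakk> \<Longrightarrow>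
      halting_run (sweeper_lba M S G)
        (to_nat (Forward c), length as, as @ bs @ [Right_End]) False (length bs)"
proof (induction bs arbitrary: c as gs)
  case Nil
  { case 1 then show ?case by auto }
  { case 2 then show ?case by simp }
next
  case (Cons x bs)
  have content: "content M x \<in> G" if "x \<in> squares G"
    using that finite_sweeperD(4)[OF fin] by (auto simp: squares_def)
  have closed: "c' \<in> S \<and> g' \<in> G" if "act M c (content M x) = Some (c', g')" "c \<in> S" "x \<in> squares G"
    for c c' g'
    using that content finite_sweeperD(5)[OF fin] by blast
  have step: "lba_step (sweeper_lba M S G)
      (to_nat (Forward c), length as, as @ (x # bs) @ [Right_End])
      (to_nat (Forward c'), length (as @ [Work g']), (as @ [Work g']) @ bs @ [Right_End])"
    if "c \<in> S" "x \<in> squares G" "act M c (content M x) = Some (c', g')" for c c' g' as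
    using lba_stepI[of "length as" "as @ (x # bs) @ [Right_End]" "Forward c" "Forward c'" "Work g'"
        Go_Right M S G] that
    by (auto simp: machine_trans_def)
  { case 1
    then obtain c1 g1 gs1 where *: "act M c (content M x) = Some (c1, g1)"
      "sweep (act M) c1 (map (content M) bs) = Some (c', gs1)" "gs = g1 # gs1"
      by (auto split: option.splits)
    then show ?case
      using Cons.IH(1)[of c1 gs1 "as @ [Work g1]"] step[of c c1 g1 as] closed[of c c1 g1] 1
      by (auto intro: relpowp_Suc_I2 simp del: relpowp.simps(2)) }
  { case 2
    show ?case
    proof (cases "act M c (content M x)")
      case None
      have "halting_run (sweeper_lba M S G)
        (to_nat (Forward c), length as, as @ (x # bs) @ [Right_End]) False 0"
        using None 2 squares_not_ends[of x G]
        by (intro halting_run_stuck lba_step_stuck)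
          (auto simp: machine_trans_def sweeper_lba_def)
      then show ?thesis by (rule halting_run_mono) simp
    next
      case (Some cg)
      then obtain c1 g1 where *: "act M c (content M x) = Some (c1, g1)" by (cases cg) auto
      then have "halting_run (sweeper_lba M S G) (to_nat (Forward c1), length (as @ [Work g1]),
          (as @ [Work g1]) @ bs @ [Right_End]) False (length bs)"
        using 2 closed[of c c1 g1] by (intro Cons.IH(2)) (auto split: option.splits)
      from halting_run_step[where m = 1, OF _ this] step[of c c1 g1 as] * 2 show ?thesis
        by (simp add: eq_OO)
    qed }
qed

lemma backward_pass:
  assumes "c \<in> S" "set bs \<subseteq> squares G"
  shows "(lba_step (sweeper_lba M S G) ^^ (length bs + 1))
      (to_nat (Backward c), length bs, Left_End # bs @ cs) (to_nat (Forward c), 1, Left_End # bs @ cs)"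
  using assms(2)
proof (induction bs arbitrary: cs rule: rev_induct)
  case Nil
  have "lba_step (sweeper_lba M S G) (to_nat (Backward c), 0, Left_End # cs)
      (to_nat (Forward c), move_head Go_Right 0, (Left_End # cs)[0 := Left_End])"
    using assms(1) by (intro lba_stepI) (auto simp: machine_trans_def)
  then show ?case by (auto simp: eq_OO)
next
  case (snoc x bs)
  have "lba_step (sweeper_lba M S G) (to_nat (Backward c), length (bs @ [x]), Left_End # (bs @ [x]) @ cs)
      (to_nat (Backward c), move_head Go_Left (length (bs @ [x])),
       (Left_End # (bs @ [x]) @ cs)[length (bs @ [x]) := x])"
    using assms(1) snoc.prems by (intro lba_stepI) (auto simp: machine_trans_def nth_append)
  then have "lba_step (sweeper_lba M S G)
      (to_nat (Backward c), length (bs @ [x]), Left_End # (bs @ [x]) @ cs)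
      (to_nat (Backward c), length bs, Left_End # bs @ (x # cs))"
    by (simp add: list_update_append)
  moreover have "(lba_step (sweeper_lba M S G) ^^ (length bs + 1))
      (to_nat (Backward c), length bs, Left_End # bs @ (x # cs))
      (to_nat (Forward c), 1, Left_End # bs @ (x # cs))"
    using snoc.prems by (intro snoc.IH) auto
  ultimately show ?case
    using relpowp_Suc_I2[of "lba_step (sweeper_lba M S G)"] by fastforce
qed

text \<open>
  A pass over \<open>n\<close> squares takes \<open>n\<close> steps to the right, one step at the right end-marker,
  which moves onto the last square or halts, \<open>n\<close> steps to the left and one step off the left
  end-marker.
\<close>

lemma halting_run_outcome:
  assumes fin: "finite_sweeper M S G" and "outcome M c u b n"
    and "c \<in> S" "set bs \<subseteq> squares G" "map (content M) bs = u"
  shows "halting_run (sweeper_lba M S G) (to_nat (Forward c), 1, Left_End # bs @ [Right_End])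
     b (n * (2 * length bs + 2))"
  using assms(2-)
proof (induction arbitrary: bs rule: outcome.induct)
  case (stuck c u)
  have "halting_run (sweeper_lba M S G)
      (to_nat (Forward c), length [Left_End], [Left_End] @ bs @ [Right_End]) False (length bs)"
    using forward_pass(2)[OF fin, where c = c and bs = bs and as = "[Left_End]"] stuck by auto
  from halting_run_mono[OF this, of "1 * (2 * length bs + 2)"] show ?case by simp
next
  case (accept c u c' u')
  from forward_pass(1)[OF fin, of c bs c' u' "[Left_End]"] accept
  have pass: "c' \<in> S" "(lba_step (sweeper_lba M S G) ^^ length bs)
        (to_nat (Forward c), 1, Left_End # bs @ [Right_End])
        (to_nat (Forward c'), Suc (length bs), Left_End # map Work u' @ [Right_End])"
    by auto
  let ?xs = "Left_End # map Work u' @ [Right_End]"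
  have len: "length u' = length bs" using accept sweep_length[of "act M" c u c' u'] by auto
  have "lba_step (sweeper_lba M S G) (to_nat (Forward c'), Suc (length bs), ?xs)
      (to_nat Halted, move_head Stay (Suc (length bs)), ?xs[Suc (length bs) := Right_End])"
    using pass(1) accept(2) len by (intro lba_stepI) (auto simp: machine_trans_def nth_append)
  moreover have "halting_run (sweeper_lba M S G)
      (to_nat Halted, move_head Stay (Suc (length bs)), ?xs[Suc (length bs) := Right_End]) True 0"
    by (intro halting_run_stuck lba_step_stuck) (auto simp: machine_trans_def sweeper_lba_def)
  ultimately have "halting_run (sweeper_lba M S G)
      (to_nat (Forward c'), Suc (length bs), ?xs) True (1 + 0)"
    by (intro halting_run_step[where m = 1]) (auto simp: eq_OO)
  from halting_run_mono[OF halting_run_step[OF pass(2) this], of "1 * (2 * length bs + 2)"]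
  show ?case by simp
next
  case (reject c u c' u')
  from forward_pass(1)[OF fin, of c bs c' u' "[Left_End]"] reject
  have pass: "(lba_step (sweeper_lba M S G) ^^ length bs)
        (to_nat (Forward c), 1, Left_End # bs @ [Right_End])
        (to_nat (Forward c'), Suc (length bs), Left_End # map Work u' @ [Right_End])"
    by auto
  let ?xs = "Left_End # map Work u' @ [Right_End]"
  have len: "length u' = length bs" using reject sweep_length[of "act M" c u c' u'] by auto
  have "halting_run (sweeper_lba M S G) (to_nat (Forward c'), Suc (length bs), ?xs) False 0"
    using len reject(2)
    by (intro halting_run_stuck lba_step_stuck)
      (auto simp: machine_trans_def sweeper_lba_def nth_append squares_def)
  from halting_run_mono[OF halting_run_step[OF pass this], of "1 * (2 * length bs + 2)"]
  show ?case by simp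
next
  case (continue c u c' u' c'' b n)
  from forward_pass(1)[OF fin, of c bs c' u' "[Left_End]"] continue.prems continue.hyps(1)
  have pass: "c' \<in> S" "set u' \<subseteq> G" "(lba_step (sweeper_lba M S G) ^^ length bs)
        (to_nat (Forward c), 1, Left_End # bs @ [Right_End])
        (to_nat (Forward c'), Suc (length bs), Left_End # map Work u' @ [Right_End])"
    by auto
  let ?xs = "Left_End # map Work u' @ [Right_End]"
  have len: "length u' = length bs"
    using continue.prems continue.hyps(1) sweep_length[of "act M" c u c' u'] by auto
  have c'': "c'' \<in> S"
    using pass(1) continue.hyps(2) finite_sweeperD(6)[OF fin] by blast
  have squares: "set (map Work u') \<subseteq> squares G" using pass(2) by (auto simp: squares_def)
  have "lba_step (sweeper_lba M S G) (to_nat (Forward c'), Suc (length bs), ?xs)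
      (to_nat (Backward c''), move_head Go_Left (Suc (length bs)), ?xs[Suc (length bs) := Right_End])"
    using pass(1) continue.hyps(2) len
    by (intro lba_stepI) (auto simp: machine_trans_def nth_append)
  then have turn: "(lba_step (sweeper_lba M S G) ^^ 1) (to_nat (Forward c'), Suc (length bs), ?xs)
      (to_nat (Backward c''), length bs, ?xs)"
    using len by (simp add: list_update_append eq_OO)
  have return: "(lba_step (sweeper_lba M S G) ^^ (length bs + 1))
      (to_nat (Backward c''), length bs, ?xs) (to_nat (Forward c''), 1, ?xs)"
    using backward_pass[OF c'' squares, of M "[Right_End]"] len by simp
  have "halting_run (sweeper_lba M S G) (to_nat (Forward c''), 1, ?xs) b
      (n * (2 * length (map Work u' :: ('a, nat) tape_symbol list) + 2))"
    using c'' squares by (intro continue.IH) (auto simp: comp_def)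
  from halting_run_step[OF pass(3) halting_run_step[OF turn halting_run_step[OF return this]]]
  show ?case by (rule halting_run_mono) (simp add: len)
qed

lemma lba_if_sweep_decidable:
  fixes L :: "'a::finite list set"
  assumes "sweep_decidable L"
  shows "\<exists>N :: (nat, nat, 'a) lba. is_lba N \<and> lba_language N = L \<and> polynomial_time_lba N"
proof -
  obtain M :: "(nat, nat, 'a) sweeper" and S G P
    where fin: "finite_sweeper M S G" and dec: "decides_within M L P"
    using assms unfolding sweep_decidable_def by blast
  let ?N = "sweeper_lba M S G"
  have "lba_time_bounded ?N w (poly (P * [:2, 2:]) (length w)) \<and> (w \<in> lba_language ?N \<longleftrightarrow> w \<in> L)" for w
  proof -
    obtain n where n: "n \<le> poly P (length w)" "outcome M (start M) (map (cell M) w) (w \<in> L) n"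
      using dec unfolding decides_within_def by blast
    have run: "halting_run ?N (to_nat (Forward (start M)), 1, Left_End # map Input w @ [Right_End])
        (w \<in> L) (n * (2 * length (map Input w :: ('a, nat) tape_symbol list) + 2))"
      using n(2) finite_sweeperD(3)[OF fin]
      by (intro halting_run_outcome[OF fin]) (auto simp: squares_def comp_def)
    have "halting_run ?N (lba_init ?N w) (w \<in> L) (poly (P * [:2, 2:]) (length w))"
    proof -
      have "n * (2 * length (map Input w :: ('a, nat) tape_symbol list) + 2)
          \<le> poly (P * [:2, 2:]) (length w)"
        using mult_right_mono[OF n(1), of "2 * length w + 2"] by (simp add: algebra_simps)
      from halting_run_mono[OF run this] show ?thesis by (simp add: lba_init_def sweeper_lba_def)
    qed
    moreover have "fst k \<notin> lba_accept ?N" if "lba_step ?N k k'" for k k'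
      using that
      by (cases rule: lba_step.cases)
        (auto simp: sweeper_lba_trans machine_trans_def, auto simp: sweeper_lba_def)
    ultimately show ?thesis
      using halting_run_language[of ?N w] sweeper_lba_right_unique by blast
  qed
  then have "lba_language ?N = L" "polynomial_time_lba ?N"
    unfolding polynomial_time_lba_def by blast+
  with is_lba_sweeper_lba[OF fin] show ?thesis by blast
qed

section \<open>Quantifying over a marked letter\<close>

definition mark :: "nat \<Rightarrow> ('a \<times> bool) list \<Rightarrow> ('a \<times> bool) list" where
  "mark i z = z[i := (fst (z ! i), True)]"

text \<open>
  The loop keeps a copy of the input on the tape, together with the position to be marked and the
  tape of the inner machine. One pass in a \<open>Shifting\<close> state moves the marked position one square
  to the right, like a shift register, and restarts the inner tape; the Boolean is the mark carried over
  from the square just left. If it leaves the tape at the right end, all positions have passed. The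
  state \<open>First\<close> feeds the mark in at the left end; it survives only on the empty tape, which is
  rejected.
\<close>

datatype 's loop_state = First | Shifting bool | Running 's

instance loop_state :: (countable) countable
  by countable_datatype

fun loop_act :: "('s, 'g, 'a \<times> bool) sweeper \<Rightarrow> 's loop_state \<Rightarrow> ('a \<times> bool) \<times> bool \<times> 'g \<Rightarrow>
    ('s loop_state \<times> (('a \<times> bool) \<times> bool \<times> 'g)) option" where
  "loop_act M First (x, here, g) = Some (Shifting False, (x, True, cell M (fst x, True)))"
| "loop_act M (Shifting b) (x, here, g) = Some (Shifting here, (x, b, cell M (fst x, snd x \<or> b)))"
| "loop_act M (Running c) (x, here, g) =
     map_option (\<lambda>(c', g'). (Running c', (x, here, g'))) (act M c g)"

fun loop_verdict :: "('s, 'g, 'a \<times> bool) sweeper \<Rightarrow> 's loop_state \<Rightarrow> 's loop_state verdict" where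
  "loop_verdict M First = Reject"
| "loop_verdict M (Shifting b) = (if b then Accept else Continue (Running (start M)))"
| "loop_verdict M (Running c) =
     (case verdict M c of Accept \<Rightarrow> Continue (Shifting False) | Reject \<Rightarrow> Reject
      | Continue c' \<Rightarrow> Continue (Running c'))"

definition mark_loop :: "('s, 'g, 'a \<times> bool) sweeper \<Rightarrow>
    ('s loop_state, ('a \<times> bool) \<times> bool \<times> 'g, 'a \<times> bool) sweeper" where
  "mark_loop M = \<lparr> start = First, cell = (\<lambda>x. (x, False, cell M x)), act = loop_act M,
     verdict = loop_verdict M \<rparr>"

text \<open>
  A square of the loop consists of the input letter, the flag for the marked position and the inner
  square. The first two are not touched by the inner machine.
\<close>

definition skeleton :: "(('a \<times> bool) \<times> bool \<times> 'g) list \<Rightarrow> (('a \<times> bool) \<times> bool) list" where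
  "skeleton u = map (\<lambda>(x, b, g). (x, b)) u"

definition inner :: "(('a \<times> bool) \<times> bool \<times> 'g) list \<Rightarrow> 'g list" where
  "inner u = map (\<lambda>(x, b, g). g) u"

lemma sweep_running:
  shows "sweep (act M) c (inner u) = None \<Longrightarrow> sweep (loop_act M) (Running c) u = None"
    and "sweep (act M) c (inner u) = Some (c', g') \<Longrightarrow>
      \<exists>u'. sweep (loop_act M) (Running c) u = Some (Running c', u') \<and>
        skeleton u' = skeleton u \<and> inner u' = g'"
proof (induction u arbitrary: c c' g')
  case Nil
  { case 1 then show ?case by (simp add: inner_def) }
  { case 2 then show ?case by (simp add: inner_def skeleton_def) }
next
  case (Cons y u)
  obtain x b g where y: "y = (x, b, g)" by (cases y) auto
  { case 1
    then show ?case
      using Cons.IH(1) by (auto simp: inner_def y split: option.splits) }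
  { case 2
    then obtain c1 g1 g'' where *: "act M c g = Some (c1, g1)"
        "sweep (act M) c1 (inner u) = Some (c', g'')" "g' = g1 # g''"
      by (auto simp: inner_def y split: option.splits)
    from Cons.IH(2)[OF *(2)] obtain u' where
      "sweep (loop_act M) (Running c1) u = Some (Running c', u')"
      "skeleton u' = skeleton u" "inner u' = g''" by blast
    then show ?case
      using * by (intro exI[of _ "(x, b, g1) # u'"]) (auto simp: y inner_def skeleton_def) }
qed

text \<open>
  Shifting replaces the list of flags by the same list with the carried flag in front and without
  its last element, which is the flag carried out of the tape.
\<close>

lemma sweep_shifting:
  "\<exists>u'. sweep (loop_act M) (Shifting b) u = Some (Shifting (last (b # map snd (skeleton u))), u') \<and>
     skeleton u' = zip (map fst (skeleton u)) (butlast (b # map snd (skeleton u))) \<and>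
     inner u' = map (\<lambda>(x, b). cell M (fst x, snd x \<or> b)) (skeleton u')"
proof (induction u arbitrary: b)
  case Nil
  show ?case by (simp add: skeleton_def inner_def)
next
  case (Cons y u)
  obtain x b' g where y: "y = (x, b', g)" by (cases y) auto
  from Cons[of b'] obtain u' where
    "sweep (loop_act M) (Shifting b') u = Some (Shifting (last (b' # map snd (skeleton u))), u')"
    "skeleton u' = zip (map fst (skeleton u)) (butlast (b' # map snd (skeleton u)))"
    "inner u' = map (\<lambda>(x, b). cell M (fst x, snd x \<or> b)) (skeleton u')" by blast
  then show ?case
    by (intro exI[of _ "(x, b, cell M (fst x, snd x \<or> b)) # u'"])
      (auto simp: y skeleton_def inner_def)
qed

text \<open>
  Rejection by the inner machine is final; after its acceptance the loop continues from an unknown inner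
  tape. Therefore the bound \<open>K\<close> on the remaining passes is required to be uniform in it.
\<close>

lemma outcome_running:
  assumes "outcome M c gs b n" "inner u = gs"
  shows "\<not> b \<Longrightarrow> outcome (mark_loop M) (Running c) u False n"
    and "b \<Longrightarrow>
      (\<And>u'. skeleton u' = skeleton u \<Longrightarrow> \<exists>m\<le>K. outcome (mark_loop M) (Shifting False) u' b' m) \<Longrightarrow>
      \<exists>m\<le>n + K. outcome (mark_loop M) (Running c) u b' m"
  using assms
proof (induction arbitrary: u rule: outcome.induct)
  case (stuck c gs)
  { case 1
    with stuck show ?case
      by (intro outcome.stuck) (simp add: mark_loop_def sweep_running(1)) }
  { case 2 then show ?case by simp }
next
  case (accept c gs c' gs')
  { case 1 then show ?case by simp }
  { case 2
    with accept(1) obtain u' where u': "sweep (loop_act M) (Running c) u = Some (Running c', u')"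
      "skeleton u' = skeleton u"
      using sweep_running(2) by metis
    with 2(2) obtain m where "m \<le> K" "outcome (mark_loop M) (Shifting False) u' b' m" by blast
    with u' accept(2) show ?case
      using outcome.continue[of "mark_loop M" "Running c" u "Running c'" u' "Shifting False" b' m]
      by (intro exI[of _ "Suc m"]) (simp add: mark_loop_def) }
next
  case (reject c gs c' gs')
  { case 1
    with reject(1) obtain u' where "sweep (loop_act M) (Running c) u = Some (Running c', u')"
      using sweep_running(2) by metis
    with reject(2) show ?case
      by (intro outcome.reject[of _ _ _ "Running c'" u']) (simp_all add: mark_loop_def) }
  { case 2 then show ?case by simp }
next
  case (continue c gs c' gs' c'' b n)
  { case 1
    with continue(1) obtain u' where "sweep (loop_act M) (Running c) u = Some (Running c', u')"
      "inner u' = gs'"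
      using sweep_running(2) by metis
    with 1 continue(2) continue.IH(1)[of u'] show ?case
      by (intro outcome.continue[of _ _ _ "Running c'" u' "Running c''"])
        (simp_all add: mark_loop_def) }
  { case 2
    with continue(1) obtain u' where u': "sweep (loop_act M) (Running c) u = Some (Running c', u')"
      "inner u' = gs'" "skeleton u' = skeleton u"
      using sweep_running(2) by metis
    have "\<exists>m\<le>n + K. outcome (mark_loop M) (Running c'') u' b' m"
      using 2 u' by (intro continue.IH(2)) auto
    then obtain m where "m \<le> n + K" "outcome (mark_loop M) (Running c'') u' b' m" by blast
    with u' continue(2) show ?case
      using outcome.continue[of "mark_loop M" "Running c" u "Running c'" u' "Running c''" b' m]
      by (intro exI[of _ "Suc m"]) (simp add: mark_loop_def) }
qed

text \<open>
  The skeleton of the tape while position \<open>i\<close> is marked.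
\<close>

definition spotlight :: "('a \<times> bool) list \<Rightarrow> nat \<Rightarrow> (('a \<times> bool) \<times> bool) list" where
  "spotlight z i = zip z (map (\<lambda>j. j = i) [0..<length z])"

lemma map_spotlight:
  assumes "i < length z"
  shows "map (\<lambda>(x, b). h (fst x, snd x \<or> b)) (spotlight z i) = map h (mark i z)"
  using assms
  by (intro nth_equalityI) (auto simp: spotlight_def mark_def nth_list_update)

lemma spotlight_shift:
  "butlast (False # map (\<lambda>j. j = i) [0..<n]) = map (\<lambda>j. j = Suc i) [0..<n]"
  by (intro nth_equalityI) (auto simp: nth_butlast nth_Cons split: nat.splits)

lemma last_spotlight:
  "i < n \<Longrightarrow> last (False # map (\<lambda>j. j = i) [0..<n]) \<longleftrightarrow> Suc i = n"
  by (cases n) auto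

text \<open>
  Each remaining position costs at most \<open>T\<close> passes of the inner machine and one pass for the
  shift; one more pass detects the end.
\<close>

lemma outcome_shifting:
  assumes dec: "\<And>i. i < length z \<Longrightarrow>
      \<exists>n\<le>T. outcome M (start M) (map (cell M) (mark i z)) (mark i z \<in> L) n"
    and i: "i < length z" and u: "skeleton u = spotlight z i"
  shows "\<exists>n \<le> (length z - Suc i) * (T + 1) + 1.
    outcome (mark_loop M) (Shifting False) u (\<forall>j. i < j \<and> j < length z \<longrightarrow> mark j z \<in> L) n"
  using i u
proof (induction "length z - i" arbitrary: i u rule: less_induct)
  case less
  have tracks: "map fst (skeleton u) = z" "map snd (skeleton u) = map (\<lambda>j. j = i) [0..<length z]"
    using less.prems by (simp_all add: spotlight_def)
  from sweep_shifting[of M False u] obtain u' where u':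
    "sweep (loop_act M) (Shifting False) u = Some (Shifting (Suc i = length z), u')"
    "skeleton u' = spotlight z (Suc i)"
    "inner u' = map (\<lambda>(x, b). cell M (fst x, snd x \<or> b)) (skeleton u')"
    unfolding tracks spotlight_shift last_spotlight[OF less.prems(1)] spotlight_def[symmetric] by blast
  show ?case
  proof (cases "Suc i = length z")
    case True
    have "outcome (mark_loop M) (Shifting False) u True 1"
      using True u' by (intro outcome.accept) (auto simp: mark_loop_def)
    moreover have "(\<forall>j. i < j \<and> j < length z \<longrightarrow> mark j z \<in> L) = True" using True by auto
    ultimately show ?thesis by (intro exI[of _ 1]) simp
  next
    case False
    then have i: "Suc i < length z" using less.prems by simp
    obtain n where n: "n \<le> T"
      "outcome M (start M) (map (cell M) (mark (Suc i) z)) (mark (Suc i) z \<in> L) n"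
      using dec[OF i] by blast
    have inner: "inner u' = map (cell M) (mark (Suc i) z)"
      using u' map_spotlight[OF i] by metis
    have step: "outcome (mark_loop M) (Running (start M)) u' b m \<Longrightarrow>
        outcome (mark_loop M) (Shifting False) u b (Suc m)" for b m
      using u' False by (intro outcome.continue) (auto simp: mark_loop_def)
    \<comment> \<open>The passes granted for position \<open>Suc i\<close> are split off from the bound.\<close>
    have len: "(length z - Suc i) * (T + 1) = (length z - Suc (Suc i)) * (T + 1) + (T + 1)"
      using i by (simp add: Suc_diff_Suc[symmetric])
    show ?thesis
    proof (cases "mark (Suc i) z \<in> L")
      case True
      have "\<exists>m \<le> (length z - Suc (Suc i)) * (T + 1) + 1. outcome (mark_loop M) (Shifting False) v
          (\<forall>j. Suc i < j \<and> j < length z \<longrightarrow> mark j z \<in> L) m" if "skeleton v = skeleton u'" for v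
        using that i u'(2) by (intro less.hyps) auto
      from outcome_running(2)[OF n(2) inner True this] obtain m where m:
        "m \<le> n + ((length z - Suc (Suc i)) * (T + 1) + 1)"
        "outcome (mark_loop M) (Running (start M)) u' (\<forall>j. Suc i < j \<and> j < length z \<longrightarrow> mark j z \<in> L) m"
        by blast
      have "(\<forall>j. i < j \<and> j < length z \<longrightarrow> mark j z \<in> L) \<longleftrightarrow>
          (\<forall>j. Suc i < j \<and> j < length z \<longrightarrow> mark j z \<in> L)"
        using True by (metis Suc_lessI Suc_lessD)
      then show ?thesis using step[OF m(2)] m(1) n(1) len by (intro exI[of _ "Suc m"]) simp
    next
      case False
      have "outcome (mark_loop M) (Running (start M)) u' False n"
        using outcome_running(1)[OF n(2) inner] False by simp
      then have "outcome (mark_loop M) (Shifting False) u False (Suc n)" by (rule step)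
      moreover have eq: "(\<forall>j. i < j \<and> j < length z \<longrightarrow> mark j z \<in> L) = False" using False i by auto
      ultimately show ?thesis unfolding eq using n(1) len by (intro exI[of _ "Suc n"]) simp
    qed
  qed
qed

text \<open>
  The empty word is excluded because it has no position to be marked: without this condition it would
  belong to the language for every \<open>L\<close>, whereas it is never a codeword.
\<close>

definition for_all_marks :: "('a \<times> bool) list set \<Rightarrow> ('a \<times> bool) list set" where
  "for_all_marks L = {z. z \<noteq> [] \<and> (\<forall>i < length z. mark i z \<in> L)}"

lemma decides_mark_loop:
  assumes "decides_within M L P"
  shows "decides_within (mark_loop M) (for_all_marks L) (1 + [:0, 1:] * (P + 1))"
  unfolding decides_within_def
proof
  fix z
  let ?u = "map (cell (mark_loop M)) z"
  let ?T = "poly P (length z)"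
  have dec: "\<exists>n\<le>?T. outcome M (start M) (map (cell M) (mark i z)) (mark i z \<in> L) n" for i
    using assms unfolding decides_within_def by (metis length_list_update mark_def)
  show "\<exists>n\<le>poly (1 + [:0, 1:] * (P + 1)) (length z).
      outcome (mark_loop M) (start (mark_loop M)) ?u (z \<in> for_all_marks L) n"
  proof (cases z)
    case Nil
    have "outcome (mark_loop M) First [] False 1"
      by (rule outcome.reject) (auto simp: mark_loop_def)
    then show ?thesis using Nil by (intro exI[of _ 1]) (auto simp: mark_loop_def for_all_marks_def)
  next
    case (Cons x z')
    let ?v = "map (cell (mark_loop M)) z'"
    have tracks: "map fst (skeleton ?v) = z'" "map snd (skeleton ?v) = replicate (length z') False"
      by (auto simp: mark_loop_def skeleton_def comp_def map_replicate_const)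
    have track': "last (False # replicate (length z') False) = False"
       "butlast (False # replicate (length z') False) = replicate (length z') False"
      by (auto simp: butlast_conv_take simp flip: replicate_Suc)
    from sweep_shifting[of M False ?v] obtain u' where u':
      "sweep (loop_act M) (Shifting False) ?v = Some (Shifting False, u')"
      "skeleton u' = zip z' (replicate (length z') False)"
      "inner u' = map (\<lambda>(x, b). cell M (fst x, snd x \<or> b)) (skeleton u')"
      unfolding tracks track' by blast
    define u where "u = (x, True, cell M (fst x, True)) # u'"
    have first: "sweep (loop_act M) First ?u = Some (Shifting False, u)"
      using u' by (simp add: Cons u_def mark_loop_def)
    have sk: "skeleton u = spotlight z 0"
    proof -
      have "map (\<lambda>j. j = 0) [0..<Suc m] = True # replicate m False" for m
        by (intro nth_equalityI) (auto simp: nth_Cons simp del: upt_Suc split: nat.splits)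
      then show ?thesis
        using u'(2) by (simp add: u_def skeleton_def spotlight_def Cons del: upt_Suc)
    qed
    have "inner u = map (\<lambda>(x, b). cell M (fst x, snd x \<or> b)) (skeleton u)"
      using u'(3) by (simp add: u_def inner_def skeleton_def)
    then have inner: "inner u = map (cell M) (mark 0 z)"
      unfolding sk using map_spotlight[of 0 z "cell M"] Cons by simp
    obtain n where n: "n \<le> ?T" "outcome M (start M) (map (cell M) (mark 0 z)) (mark 0 z \<in> L) n"
      using dec by blast
    have step: "outcome (mark_loop M) (Running (start M)) u b m \<Longrightarrow>
        outcome (mark_loop M) First ?u b (Suc m)" for b m
      using first by (intro outcome.continue) (auto simp: mark_loop_def)
    have len: "length z * (?T + 1) = (length z - Suc 0) * (?T + 1) + (?T + 1)"
      by (simp add: Cons)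
    have "\<exists>m \<le> 1 + length z * (?T + 1). outcome (mark_loop M) First ?u (z \<in> for_all_marks L) m"
    proof (cases "mark 0 z \<in> L")
      case True
      have "\<exists>m \<le> (length z - Suc 0) * (?T + 1) + 1. outcome (mark_loop M) (Shifting False) v
          (\<forall>j. 0 < j \<and> j < length z \<longrightarrow> mark j z \<in> L) m" if "skeleton v = skeleton u" for v
        using that sk dec Cons by (intro outcome_shifting) auto
      from outcome_running(2)[OF n(2) inner True this] obtain m where m:
        "m \<le> n + ((length z - Suc 0) * (?T + 1) + 1)"
        "outcome (mark_loop M) (Running (start M)) u (\<forall>j. 0 < j \<and> j < length z \<longrightarrow> mark j z \<in> L) m"
        by blast
      have "(\<forall>j. 0 < j \<and> j < length z \<longrightarrow> mark j z \<in> L) \<longleftrightarrow> z \<in> for_all_marks L"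
        using True Cons unfolding for_all_marks_def by (auto, metis neq0_conv length_Cons)
      then show ?thesis using step[OF m(2)] m(1) n(1) len by (intro exI[of _ "Suc m"]) simp
    next
      case False
      have "outcome (mark_loop M) (Running (start M)) u False n"
        using outcome_running(1)[OF n(2) inner] False by simp
      then have "outcome (mark_loop M) First ?u False (Suc n)" by (rule step)
      moreover have "z \<notin> for_all_marks L" using False Cons by (auto simp: for_all_marks_def)
      ultimately show ?thesis using n(1) len by (intro exI[of _ "Suc n"]) auto
    qed
    then show ?thesis by (simp add: mark_loop_def)
  qed
qed

lemma finite_mark_loop:
  fixes M :: "('s, 'g, 'a::finite \<times> bool) sweeper"
  assumes "finite_sweeper M S G"
  shows "finite_sweeper (mark_loop M) (insert First (range Shifting \<union> Running ` S)) (UNIV \<times> UNIV \<times> G)"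
proof -
  note D = finite_sweeperD[OF assms]
  show ?thesis
    unfolding finite_sweeper_def
  proof (intro conjI ballI allI impI)
    fix c g c' g'
    assume c: "c \<in> insert First (range Shifting \<union> Running ` S)"
      and g: "g \<in> UNIV \<times> UNIV \<times> G"
      and *: "act (mark_loop M) c g = Some (c', g')"
    obtain x b y where "g = (x, b, y)" by (cases g) auto
    then show "c' \<in> insert First (range Shifting \<union> Running ` S)" "g' \<in> UNIV \<times> UNIV \<times> G"
      using c g * by (auto simp: mark_loop_def D(4) dest!: D(5))
  next
    fix c c'
    assume "c \<in> insert First (range Shifting \<union> Running ` S)"
      and "verdict (mark_loop M) c = Continue c'"
    then show "c' \<in> insert First (range Shifting \<union> Running ` S)"
      using D(3) by (auto simp: mark_loop_def D(6) split: verdict.splits if_splits)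
  qed (use D(1-4) in \<open>auto simp: mark_loop_def\<close>)
qed

lemma sweep_decidable_for_all_marks:
  fixes L :: "('a::finite \<times> bool) list set"
  assumes "sweep_decidable L"
  shows "sweep_decidable (for_all_marks L)"
  using assms finite_mark_loop decides_mark_loop sweep_decidableI
  unfolding sweep_decidable_def by metis

section \<open>Decoding on the tape\<close>

instance it_letter :: finite
proof
  have "UNIV = {It_l, It_r, It_m, It_f, It_t}" using it_letter.exhaust by blast
  then show "finite (UNIV :: it_letter set)" by (metis finite.emptyI finite.insertI)
qed

text \<open>
  The tape alphabet of the decoder. Slots to the left of the next slot are \<open>Skipped\<close>, so that the
  next slot is always the first \<open>Open\<close> one and no pointer into the list is needed. The number in an
  \<open>Item\<close> is the rank in time among the marked insertions, or \<open>0\<close> if the insertion is not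
  marked.
\<close>

datatype token = Blank | Open | Skipped | Item nat

instance token :: countable
  by countable_datatype

text \<open>
  What replaces the first \<open>Open\<close> token. Reading a \<open>t\<close> just skips this slot.
\<close>

fun filling :: "it_letter \<Rightarrow> nat \<Rightarrow> token list" where
  "filling It_l v = [Item v, Open]"
| "filling It_r v = [Open, Item v]"
| "filling It_m v = [Open, Item v, Open]"
| "filling It_f v = [Item v]"
| "filling It_t v = [Skipped]"

text \<open>
  An insertion resets the next slot to the first one. Only tokens in front of the next slot can be
  \<open>Skipped\<close>, so it is enough to restore these while looking for it.
\<close>

definition restore :: "it_letter \<Rightarrow> token \<Rightarrow> token" where
  "restore a t = (if a \<noteq> It_t \<and> t = Skipped then Open else t)"

fun edit :: "it_letter \<Rightarrow> nat \<Rightarrow> token list \<Rightarrow> token list option" where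
  "edit a v [] = None"
| "edit a v (t # ts) =
     (if t = Open then Some (filling a v @ ts) else map_option ((#) (restore a t)) (edit a v ts))"

text \<open>
  A mark on a \<open>t\<close> is ignored, as this letter inserts nothing.
\<close>

definition counted :: "it_letter \<times> bool \<Rightarrow> bool" where
  "counted x \<longleftrightarrow> snd x \<and> fst x \<noteq> It_t"

fun ranks :: "token list \<Rightarrow> nat list" where
  "ranks [] = []"
| "ranks (Item v # ts) = (if v = 0 then ranks ts else v # ranks ts)"
| "ranks (_ # ts) = ranks ts"

text \<open>
  The decoder at the level of token lists. The parameter \<open>n\<close> is the available space and \<open>r\<close>
  the number of marked insertions so far. More than \<open>length q\<close> marked insertions are rejected, which
  keeps the ranks bounded.
\<close>

fun simulate :: "'b::linorder list \<Rightarrow> nat \<Rightarrow> token list \<Rightarrow> nat \<Rightarrow> (it_letter \<times> bool) list \<Rightarrow> bool" where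
  "simulate q n ts r [] \<longleftrightarrow> set ts \<subseteq> range Item \<and> \<not> order_isomorphic (ranks ts) q"
| "simulate q n ts r (x # zs) \<longleftrightarrow>
     (let r' = (if counted x then Suc r else r); v = (if counted x then Suc r else 0)
      in r' \<le> length q \<and>
         (case edit (fst x) v ts of None \<Rightarrow> False
          | Some ts' \<Rightarrow> length ts' \<le> n \<and> simulate q n ts' r' zs))"

text \<open>
  One letter is processed in two passes. \<open>Fetch\<close> takes the next letter off the tape and keeps it
  in \<open>Fetched\<close> until the pass ends. \<open>Edit\<close> looks for the first open slot, and \<open>Shift\<close>
  moves the rest of the list to the right, the list being the tokens that wait for a square. After the
  last letter, \<open>Check\<close> collects the ranks.
\<close>

datatype sim_state = Init | Fetch nat | Fetched nat "it_letter \<times> bool" | Edit it_letter nat nat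
  | Shift "token list" nat | Check "nat list"

instance sim_state :: countable
  by countable_datatype

text \<open>
  \<open>Check\<close> need not keep more than \<open>Suc k\<close> ranks: a longer list is not order isomorphic to
  a pattern of length \<open>k\<close> either.
\<close>

fun token_act :: "nat \<Rightarrow> sim_state \<Rightarrow> token \<Rightarrow> (sim_state \<times> token) option" where
  "token_act k Init t = Some (Shift [] 0, Open)"
| "token_act k (Edit a v r) t =
     (if t = Open then Some (Shift (tl (filling a v)) r, hd (filling a v))
      else Some (Edit a v r, restore a t))"
| "token_act k (Shift us r) t =
     (case if t = Blank then us else us @ [t] of [] \<Rightarrow> Some (Shift [] r, Blank)
      | u # us' \<Rightarrow> Some (Shift us' r, u))"
| "token_act k (Check vs) Blank = Some (Check vs, Blank)"
| "token_act k (Check vs) (Item v) =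
     Some (Check (if v = 0 then vs else take (Suc k) (vs @ [v])), Item v)"
| "token_act k _ _ = None"

text \<open>
  A square holds a letter that has not been read yet, if any, and a token.
\<close>

fun sim_act :: "nat \<Rightarrow> sim_state \<Rightarrow> (it_letter \<times> bool) option \<times> token \<Rightarrow>
    (sim_state \<times> ((it_letter \<times> bool) option \<times> token)) option" where
  "sim_act k (Fetch r) (None, t) = Some (Fetch r, (None, t))"
| "sim_act k (Fetch r) (Some x, t) = Some (Fetched r x, (None, t))"
| "sim_act k (Fetched r x) c = Some (Fetched r x, c)"
| "sim_act k s (y, t) = map_option (apsnd (Pair y)) (token_act k s t)"

fun sim_verdict :: "'b::linorder list \<Rightarrow> sim_state \<Rightarrow> sim_state verdict" where
  "sim_verdict q (Fetch r) = Continue (Check [])"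
| "sim_verdict q (Fetched r x) =
     (let r' = (if counted x then Suc r else r); v = (if counted x then Suc r else 0)
      in if r' \<le> length q then Continue (Edit (fst x) v r') else Reject)"
| "sim_verdict q (Shift [] r) = Continue (Fetch r)"
| "sim_verdict q (Check vs) = (if order_isomorphic vs q then Reject else Accept)"
| "sim_verdict q _ = Reject"

definition simulator :: "'b::linorder list \<Rightarrow>
    (sim_state, (it_letter \<times> bool) option \<times> token, it_letter \<times> bool) sweeper" where
  "simulator q = \<lparr> start = Init, cell = (\<lambda>x. (Some x, Blank)), act = sim_act (length q),
     verdict = sim_verdict q \<rparr>"

fun token_state :: "sim_state \<Rightarrow> bool" where
  "token_state (Fetch r) = False"
| "token_state (Fetched r x) = False"
| "token_state _ = True"

lemma token_state_step: "token_act k s t = Some (s', t') \<Longrightarrow> token_state s'"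
  by (induction k s t rule: token_act.induct) (auto split: if_splits list.splits)

lemma sim_act_token_state:
  "token_state s \<Longrightarrow> sim_act k s (y, t) = map_option (apsnd (Pair y)) (token_act k s t)"
  by (cases s) auto

lemma sweep_token_state:
  "length ys = length ts \<Longrightarrow> token_state s \<Longrightarrow>
     sweep (sim_act k) s (zip ys ts) = map_option (apsnd (zip ys)) (sweep (token_act k) s ts)"
proof (induction ys ts arbitrary: s rule: list_induct2)
  case (Cons y ys t ts)
  show ?case
  proof (cases "token_act k s t")
    case (Some st)
    then obtain s' t' where st: "token_act k s t = Some (s', t')" by (cases st) auto
    with Cons.IH[of s'] token_state_step[OF st] Cons.prems show ?thesis
      by (cases "sweep (token_act k) s' ts") (auto simp: sim_act_token_state)
  qed (simp add: sim_act_token_state Cons.prems)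
qed simp

lemma sweep_shift_blanks:
  "sweep (token_act k) (Shift us r) (replicate m Blank) =
     Some (Shift (drop m us) r, take m (us @ replicate m Blank))"
proof (induction m arbitrary: us)
  case (Suc m)
  then show ?case
    by (cases us) (auto, simp del: replicate.simps add: replicate.simps(2)[symmetric])
qed simp

text \<open>
  The tokens left over in the state at the end of the pass are those for which the tape is too
  short.
\<close>

lemma sweep_shift:
  assumes "Blank \<notin> set ts"
  shows "sweep (token_act k) (Shift us r) (ts @ replicate m Blank) =
     Some (Shift (drop (length ts + m) (us @ ts)) r,
       take (length ts + m) (us @ ts @ replicate m Blank))"
  using assms
proof (induction ts arbitrary: us)
  case Nil
  then show ?case by (simp add: sweep_shift_blanks)
next
  case (Cons t ts)
  then have t: "t \<noteq> Blank" "Blank \<notin> set ts" by auto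
  show ?case
  proof (cases us)
    case Nil
    then show ?thesis using Cons.IH[of "[]"] t by simp
  next
    case (Cons u us')
    then show ?thesis using Cons.IH[of "us' @ [t]"] t by simp
  qed
qed

lemma filling_ne: "filling a v \<noteq> []"
  by (cases a) auto

lemma sweep_edit_None:
  assumes "edit a v ts = None"
  shows "\<exists>ts'. sweep (token_act k) (Edit a v r) (ts @ replicate m Blank) = Some (Edit a v r, ts')"
  using assms
proof (induction ts)
  case Nil
  show ?case by (induction m) (auto simp: restore_def)
qed (auto split: if_splits)

lemma sweep_edit_Some:
  assumes "edit a v ts = Some ts'" "Blank \<notin> set ts"
  shows "sweep (token_act k) (Edit a v r) (ts @ replicate m Blank) =
     Some (Shift (drop (length ts + m) ts') r, take (length ts + m) (ts' @ replicate m Blank))"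
  using assms
proof (induction ts arbitrary: ts')
  case (Cons t ts)
  show ?case
  proof (cases "t = Open")
    case True
    obtain u us where fill: "filling a v = u # us" using filling_ne by (cases "filling a v") auto
    then show ?thesis
      using Cons.prems True by (auto simp: sweep_shift)
  next
    case False
    then show ?thesis using Cons by auto
  qed
qed simp

lemma edit_length: "edit a v ts = Some ts' \<Longrightarrow> length ts \<le> length ts'"
proof (induction ts arbitrary: ts')
  case (Cons t ts)
  have "length (filling a v) > 0" using filling_ne by simp
  with Cons show ?case by (auto split: if_splits simp: Suc_leI)
qed simp

lemma edit_no_Blank: "edit a v ts = Some ts' \<Longrightarrow> Blank \<notin> set ts \<Longrightarrow> Blank \<notin> set ts'"
proof (induction ts arbitrary: ts')
  case (Cons t ts)
  have "Blank \<notin> set (filling a v)" by (cases a) auto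
  with Cons show ?case by (auto split: if_splits simp: restore_def)
qed simp

lemma sweep_check_blanks:
  "sweep (token_act k) (Check vs) (replicate m Blank) = Some (Check vs, replicate m Blank)"
  by (induction m) auto

lemma sweep_check_Some:
  assumes "set ts \<subseteq> range Item" "length vs \<le> Suc k"
  shows "sweep (token_act k) (Check vs) (ts @ replicate m Blank) =
     Some (Check (take (Suc k) (vs @ ranks ts)), ts @ replicate m Blank)"
  using assms
proof (induction ts arbitrary: vs)
  case Nil
  then show ?case by (simp add: sweep_check_blanks)
next
  case (Cons t ts)
  then obtain v where t: "t = Item v" by auto
  have "take (Suc k) (take (Suc k) (vs @ [v]) @ ranks ts) = take (Suc k) (vs @ v # ranks ts)"
    using Cons.prems(2) by (cases "length vs = Suc k") auto
  then show ?case
    using Cons.IH[of vs] Cons.IH[of "take (Suc k) (vs @ [v])"] Cons.prems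
    by (auto simp: t simp del: take_append)
qed

lemma sweep_check_None:
  assumes "\<not> set ts \<subseteq> range Item" "Blank \<notin> set ts"
  shows "sweep (token_act k) (Check vs) (ts @ us) = None"
  using assms
proof (induction ts arbitrary: vs)
  case (Cons t ts)
  then show ?case by (cases t) auto
qed simp

lemma sweep_fetched: "sweep (sim_act k) (Fetched r x) u = Some (Fetched r x, u)"
  by (induction u) auto

lemma sweep_fetch:
  assumes "length ts = m + Suc (length zs)"
  shows "sweep (sim_act k) (Fetch r) (zip (replicate m None @ map Some (x # zs)) ts) =
     Some (Fetched r x, zip (replicate (Suc m) None @ map Some zs) ts)"
  using assms
proof (induction m arbitrary: ts)
  case 0
  then show ?case by (cases ts) (auto simp: sweep_fetched)
next
  case (Suc m)
  then obtain t ts' where "ts = t # ts'" by (cases ts) auto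
  then show ?case using Suc by auto
qed

lemma sweep_fetch_done:
  "sweep (sim_act k) (Fetch r) (zip (replicate m None) ts) =
     Some (Fetch r, zip (replicate m None) ts)"
proof (induction m arbitrary: ts)
  case (Suc m)
  then show ?case by (cases ts) auto
qed simp

lemma order_isomorphic_take_Suc:
  "order_isomorphic (take (Suc (length q)) vs) q \<longleftrightarrow> order_isomorphic vs q"
  by (cases "length vs \<le> Suc (length q)") (auto simp: order_isomorphic_def)

text \<open>
  Two passes for each remaining letter, then one that finds no letter left and one for the comparison
  with the pattern.
\<close>

lemma outcome_fetch:
  assumes "length ts \<le> n" "Blank \<notin> set ts" "n = m + length zs"
  shows "\<exists>j \<le> 2 * length zs + 2. outcome (simulator q) (Fetch r)
     (zip (replicate m None @ map Some zs) (ts @ replicate (n - length ts) Blank))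
     (simulate q n ts r zs) j"
  using assms
proof (induction zs arbitrary: m ts r)
  case Nil
  let ?u = "zip (replicate m None) (ts @ replicate (n - length ts) Blank)"
  have step: "outcome (simulator q) (Fetch r) ?u b (Suc j)"
    if "outcome (simulator q) (Check []) ?u b j" for b j
    using that
    by (intro outcome.continue[where c'' = "Check []"]) (auto simp: simulator_def sweep_fetch_done)
  have tracks: "sweep (sim_act (length q)) (Check []) ?u =
      map_option (apsnd (zip (replicate m None)))
        (sweep (token_act (length q)) (Check []) (ts @ replicate (n - length ts) Blank))"
    using Nil by (intro sweep_token_state) auto
  have "outcome (simulator q) (Check []) ?u (simulate q n ts r []) 1"
  proof (cases "set ts \<subseteq> range Item")
    case True
    then have *: "sweep (act (simulator q)) (Check []) ?u =
        Some (Check (take (Suc (length q)) (ranks ts)), ?u)"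
      using tracks by (simp add: simulator_def sweep_check_Some)
    show ?thesis
    proof (cases "order_isomorphic (ranks ts) q")
      case True
      with outcome.reject[OF *] show ?thesis
        by (simp add: simulator_def order_isomorphic_take_Suc)
    next
      case False
      with outcome.accept[OF *] \<open>set ts \<subseteq> range Item\<close> show ?thesis
        by (simp add: simulator_def order_isomorphic_take_Suc)
    qed
  next
    case False
    then have "sweep (act (simulator q)) (Check []) ?u = None"
      using tracks Nil by (simp add: simulator_def sweep_check_None)
    from outcome.stuck[OF this] False show ?thesis by simp
  qed
  from step[OF this] show ?case by (intro exI[of _ "Suc 1"]) simp
next
  case (Cons x zs)
  let ?b = "n - length ts"
  let ?u = "zip (replicate m None @ map Some (x # zs)) (ts @ replicate ?b Blank)"
  let ?ys = "replicate (Suc m) None @ map Some zs"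
  let ?v = "zip ?ys (ts @ replicate ?b Blank)"
  define r' where "r' = (if counted x then Suc r else r)"
  define v where "v = (if counted x then Suc r else 0)"
  have fetch: "sweep (act (simulator q)) (Fetch r) ?u = Some (Fetched r x, ?v)"
    using Cons.prems by (simp add: simulator_def sweep_fetch del: list.map)
  have verdict: "verdict (simulator q) (Fetched r x) =
      (if r' \<le> length q then Continue (Edit (fst x) v r') else Reject)"
    by (simp add: simulator_def r'_def v_def)
  have sim: "simulate q n ts r (x # zs) \<longleftrightarrow> r' \<le> length q \<and>
      (case edit (fst x) v ts of None \<Rightarrow> False
       | Some ts' \<Rightarrow> length ts' \<le> n \<and> simulate q n ts' r' zs)"
    by (simp only: simulate.simps Let_def r'_def v_def)
  show ?case
  proof (cases "r' \<le> length q")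
    case False
    with outcome.reject[OF fetch] verdict sim show ?thesis by (intro exI[of _ 1]) simp
  next
    case True
    then have go: "verdict (simulator q) (Fetched r x) = Continue (Edit (fst x) v r')"
      using verdict by simp
    have tracks: "sweep (act (simulator q)) (Edit (fst x) v r') ?v =
        map_option (apsnd (zip ?ys))
          (sweep (token_act (length q)) (Edit (fst x) v r') (ts @ replicate ?b Blank))"
      unfolding simulator_def sweeper.select_convs
      using Cons.prems by (intro sweep_token_state) auto
    show ?thesis
    proof (cases "edit (fst x) v ts")
      case None
      from sweep_edit_None[OF None, of "length q" r' ?b] obtain ts' where
        "sweep (act (simulator q)) (Edit (fst x) v r') ?v = Some (Edit (fst x) v r', zip ?ys ts')"
        using tracks by auto
      then have "outcome (simulator q) (Edit (fst x) v r') ?v False 1"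
        by (rule outcome.reject) (simp add: simulator_def)
      from outcome.continue[OF fetch go this] show ?thesis
        using sim None by (intro exI[of _ "Suc 1"]) simp
    next
      case (Some ts')
      have len: "length ts + ?b = n" using Cons.prems by simp
      have sweep: "sweep (act (simulator q)) (Edit (fst x) v r') ?v =
          Some (Shift (drop n ts') r', zip ?ys (take n (ts' @ replicate ?b Blank)))"
        using tracks sweep_edit_Some[OF Some Cons.prems(2), of "length q" r' ?b] len by simp
      show ?thesis
      proof (cases "length ts' \<le> n")
        case False
        then obtain t us where "drop n ts' = t # us" by (cases "drop n ts'") auto
        then have "outcome (simulator q) (Edit (fst x) v r') ?v False 1"
          using sweep by (intro outcome.reject[OF sweep]) (simp add: simulator_def)
        from outcome.continue[OF fetch go this] show ?thesis
          using sim Some False by (intro exI[of _ "Suc 1"]) simp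
      next
        case fits: True
        have tape: "take n (ts' @ replicate ?b Blank) = ts' @ replicate (n - length ts') Blank"
          using fits edit_length[OF Some] by (simp add: min_def)
        obtain j where j: "j \<le> 2 * length zs + 2"
          "outcome (simulator q) (Fetch r') (zip ?ys (ts' @ replicate (n - length ts') Blank))
             (simulate q n ts' r' zs) j"
          using Cons.IH[of ts' "Suc m" r'] fits Cons.prems edit_no_Blank[OF Some] by auto
        have "outcome (simulator q) (Edit (fst x) v r') ?v (simulate q n ts' r' zs) (Suc j)"
          using j(2) by (rule outcome.continue[OF sweep[unfolded tape], rotated])
            (use fits in \<open>simp add: simulator_def\<close>)
        from outcome.continue[OF fetch go this] show ?thesis
          using sim Some True fits j(1) by (intro exI[of _ "Suc (Suc j)"]) simp
      qed
    qed
  qed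
qed

lemma decides_simulator:
  "decides_within (simulator q) {z. z \<noteq> [] \<and> simulate q (length z) [Open] 0 z} [:3, 2:]"
  unfolding decides_within_def
proof
  fix z :: "(it_letter \<times> bool) list"
  let ?L = "{z. z \<noteq> [] \<and> simulate q (length z) [Open] 0 z}"
  let ?u = "map (cell (simulator q)) z"
  show "\<exists>n\<le>poly [:3, 2:] (length z).
      outcome (simulator q) (start (simulator q)) ?u (z \<in> ?L) n"
  proof (cases z)
    case Nil
    have "outcome (simulator q) Init [] False 1"
      by (rule outcome.reject) (auto simp: simulator_def)
    then show ?thesis using Nil by (intro exI[of _ 1]) (auto simp: simulator_def)
  next
    case (Cons x z')
    let ?b = "replicate (length z - 1) Blank"
    have u: "?u = zip (map Some z) (Blank # ?b)"
      by (rule nth_equalityI) (auto simp: simulator_def Cons nth_Cons split: nat.splits)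
    have "sweep (act (simulator q)) Init ?u =
        map_option (apsnd (zip (map Some z))) (sweep (token_act (length q)) Init (Blank # ?b))"
      unfolding u unfolding simulator_def sweeper.select_convs by (intro sweep_token_state) (auto simp: Cons)
    also have "\<dots> = Some (Shift [] 0, zip (map Some z) ([Open] @ ?b))"
      by (simp add: sweep_shift_blanks)
    finally have init: "sweep (act (simulator q)) Init ?u = \<dots>" .
    obtain j where j: "j \<le> 2 * length z + 2"
      "outcome (simulator q) (Fetch 0) (zip (replicate 0 None @ map Some z) ([Open] @ replicate (length z - length [Open]) Blank))
          (simulate q (length z) [Open] 0 z) j"
      using outcome_fetch[of "[Open]" "length z" 0 z q 0] by (auto simp: Cons)
    have "outcome (simulator q) Init ?u (simulate q (length z) [Open] 0 z) (Suc j)"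
      using j(2) by (intro outcome.continue[OF init, where c'' = "Fetch 0"]) (simp_all add: simulator_def)
    then show ?thesis
      using j(1) by (intro exI[of _ "Suc j"]) (simp add: simulator_def Cons)
  qed
qed

text \<open>
  Bounds for the ranks of at most \<open>k\<close> marked insertions and, below, for the states that use
  them; at most two tokens wait for a square, because a slot is replaced by at most three.
\<close>

definition tokens_upto :: "nat \<Rightarrow> token set" where
  "tokens_upto k = {Blank, Open, Skipped} \<union> Item ` {..k}"

definition states_upto :: "nat \<Rightarrow> sim_state set" where
  "states_upto k = {Init} \<union> Fetch ` {..k} \<union> (\<lambda>(r, x). Fetched r x) ` ({..k} \<times> UNIV) \<union>
     (\<lambda>(a, v, r). Edit a v r) ` (UNIV \<times> {..k} \<times> {..k}) \<union>
     (\<lambda>(us, r). Shift us r) ` ({us. set us \<subseteq> tokens_upto k \<and> length us \<le> 2} \<times> {..k}) \<union>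
     Check ` {vs. set vs \<subseteq> {..k} \<and> length vs \<le> Suc k}"

lemma filling_upto:
  assumes "v \<le> k"
  shows "hd (filling a v) \<in> tokens_upto k" "set (tl (filling a v)) \<subseteq> tokens_upto k"
    "length (tl (filling a v)) \<le> 2"
  using assms by (cases a; auto simp: tokens_upto_def)+

lemma token_act_upto:
  assumes "token_act k s t = Some (s', t')" "s \<in> states_upto k" "t \<in> tokens_upto k"
  shows "s' \<in> states_upto k" "t' \<in> tokens_upto k"
proof -
  have "s' \<in> states_upto k \<and> t' \<in> tokens_upto k"
  proof (cases s)
    case Init
    then show ?thesis using assms by (auto simp: states_upto_def tokens_upto_def image_iff)
  next
    case (Edit a v r)
    then have "v \<le> k" "r \<le> k" using assms(2) by (auto simp: states_upto_def)
    moreover have "restore a t \<in> tokens_upto k"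
      using assms(3) by (auto simp: restore_def tokens_upto_def)
    ultimately show ?thesis
      using assms Edit filling_upto[of v k a] by (auto simp: states_upto_def image_iff split: if_splits)
  next
    case (Shift us r)
    then have us: "set us \<subseteq> tokens_upto k" "length us \<le> 2" "r \<le> k"
      using assms(2) by (auto simp: states_upto_def)
    define us' where "us' = (if t = Blank then us else us @ [t])"
    have us': "set us' \<subseteq> tokens_upto k" "length us' \<le> 3"
      using us assms(3) by (auto simp: us'_def)
    show ?thesis
    proof (cases us')
      case Nil
      then show ?thesis
        using assms(1) Shift us by (auto simp: us'_def[symmetric] states_upto_def image_iff tokens_upto_def)
    next
      case (Cons u vs)
      then show ?thesis
        using assms(1) Shift us us' by (auto simp: us'_def[symmetric] states_upto_def image_iff)
    qed
  next
    case (Check vs)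
    then have vs: "set vs \<subseteq> {..k}" "length vs \<le> Suc k"
      using assms(2) by (auto simp: states_upto_def)
    show ?thesis
    proof (cases t)
      case (Item v)
      then have "v \<le> k" using assms(3) by (auto simp: tokens_upto_def)
      moreover have "set (take (Suc k) (vs @ [v])) \<subseteq> insert v (set vs)"
        using set_take_subset[of "Suc k" "vs @ [v]"] by simp
      ultimately have "set (take (Suc k) (vs @ [v])) \<subseteq> {..k}" "length (take (Suc k) (vs @ [v])) \<le> Suc k"
        using vs by auto
      with assms Check Item vs show ?thesis
        by (auto simp: states_upto_def image_iff simp del: take_append split: if_splits)
    qed (use assms Check in auto)
  qed (use assms in auto)
  then show "s' \<in> states_upto k" "t' \<in> tokens_upto k" by auto
qed

lemma finite_simulator: "finite_sweeper (simulator q) (states_upto (length q)) (UNIV \<times> tokens_upto (length q))"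
proof -
  let ?k = "length q"
  have tokens: "finite (tokens_upto ?k)" by (simp add: tokens_upto_def)
  show ?thesis
    unfolding finite_sweeper_def
  proof (intro conjI ballI allI impI)
    show "finite (states_upto ?k)"
      using tokens finite_lists_length_le[OF tokens, of 2] finite_lists_length_le[of "{..?k}" "Suc ?k"]
      by (auto simp: states_upto_def)
    show "finite ((UNIV :: (it_letter \<times> bool) option set) \<times> tokens_upto ?k)" using tokens by simp
    show "start (simulator q) \<in> states_upto ?k" by (simp add: simulator_def states_upto_def)
    show "range (cell (simulator q)) \<subseteq> UNIV \<times> tokens_upto ?k"
      by (auto simp: simulator_def tokens_upto_def)
  next
    fix s c s' c'
    assume s: "s \<in> states_upto ?k" and c: "c \<in> UNIV \<times> tokens_upto ?k"
      and act: "act (simulator q) s c = Some (s', c')"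
    obtain y t where yt: "c = (y, t)" by (cases c)
    show "s' \<in> states_upto ?k" "c' \<in> UNIV \<times> tokens_upto ?k"
      using s c act token_act_upto[of ?k s t] unfolding yt simulator_def sweeper.select_convs
      by (cases s; cases y; auto simp: states_upto_def image_iff)+
  next
    fix s s'
    assume s: "s \<in> states_upto ?k" and "verdict (simulator q) s = Continue s'"
    then show "s' \<in> states_upto ?k"
      unfolding simulator_def sweeper.select_convs
      by (cases "(q, s)" rule: sim_verdict.cases)
        (auto simp: states_upto_def image_iff Let_def split: if_splits)
  qed
qed

lemma sweep_decidable_simulate:
  "sweep_decidable {z. z \<noteq> [] \<and> simulate q (length z) [Open] 0 z}"
  using finite_simulator decides_simulator by (rule sweep_decidableI)

section \<open>Tokens represent entries\<close>

abbreviation slots :: "entry list \<Rightarrow> nat" where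
  "slots xs \<equiv> count_list xs Slot"

fun numbers :: "entry list \<Rightarrow> nat list" where
  "numbers [] = []"
| "numbers (Slot # xs) = numbers xs"
| "numbers (Num a # xs) = a # numbers xs"

text \<open>
  The parameter \<open>j\<close> is the number of the next slot. It is counted down as in
  \<open>replace_slot\<close>, so that the first \<open>Open\<close> token is the slot replaced there.
\<close>

fun tokens :: "(nat \<Rightarrow> nat) \<Rightarrow> nat \<Rightarrow> entry list \<Rightarrow> token list" where
  "tokens rk j [] = []"
| "tokens rk j (Num a # xs) = Item (rk a) # tokens rk j xs"
| "tokens rk j (Slot # xs) =
     (if j \<le> 1 then Open # tokens rk j xs else Skipped # tokens rk (j - 1) xs)"

lemma length_tokens: "length (tokens rk j xs) = length xs"
  by (induction rk j xs rule: tokens.induct) auto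

lemma tokens_append_first: "tokens rk (Suc 0) (xs @ ys) = tokens rk (Suc 0) xs @ tokens rk (Suc 0) ys"
  by (induction xs rule: numbers.induct) auto

lemma ranks_tokens: "ranks (tokens rk j xs) = filter (\<lambda>v. v \<noteq> 0) (map rk (numbers xs))"
  by (induction rk j xs rule: tokens.induct) auto

lemma tokens_Item_iff: "set (tokens rk j xs) \<subseteq> range Item \<longleftrightarrow> slots xs = 0"
  by (induction rk j xs rule: tokens.induct) auto

definition new_entries :: "it_letter \<Rightarrow> nat \<Rightarrow> entry list" where
  "new_entries a i = (case a of It_l \<Rightarrow> [Num i, Slot] | It_r \<Rightarrow> [Slot, Num i]
     | It_m \<Rightarrow> [Slot, Num i, Slot] | It_f \<Rightarrow> [Num i] | It_t \<Rightarrow> [])"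

lemma it_step_insert:
  "a \<noteq> It_t \<Longrightarrow> it_step a (xs, i, j) = (replace_slot j (new_entries a i) xs, Suc i, 1)"
  by (cases a) (auto simp: new_entries_def)

lemma tokens_new_entries: "a \<noteq> It_t \<Longrightarrow> tokens rk (Suc 0) (new_entries a i) = filling a (rk i)"
  by (cases a) (auto simp: new_entries_def)

text \<open>
  After an insertion the next slot is the first one. Both sides fail or succeed together, because there
  is an open slot exactly if the list has at least \<open>j\<close> slots.
\<close>

lemma edit_insert:
  assumes "a \<noteq> It_t" "1 \<le> j"
  shows "edit a (rk i) (tokens rk j xs) =
     (if j \<le> slots xs then Some (tokens rk 1 (replace_slot j (new_entries a i) xs)) else None)"
  using assms(2)
proof (induction rk j xs rule: tokens.induct)
  case (3 rk j xs)
  then consider "j = 1" | j' where "j = Suc (Suc j')" by (cases j; cases "j - 1") auto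
  then show ?case
    using assms(1) 3 by cases (auto simp: tokens_append_first tokens_new_entries restore_def)
qed (use assms(1) in \<open>auto simp: restore_def\<close>)

lemma edit_translate:
  assumes "1 \<le> j"
  shows "edit It_t v (tokens rk j xs) = (if j \<le> slots xs then Some (tokens rk (j + 1) xs) else None)"
  using assms
proof (induction rk j xs rule: tokens.induct)
  case (3 rk j xs)
  then consider "j = 1" | j' where "j = Suc (Suc j')" by (cases j; cases "j - 1") auto
  then show ?case using 3 by cases (auto simp: restore_def)
qed (auto simp: restore_def)

lemma slots_replace:
  assumes "1 \<le> j" "j \<le> slots xs"
  shows "Suc (slots (replace_slot j us xs)) = slots us + slots xs"
  using assms by (induction j us xs rule: replace_slot.induct) auto

lemma length_replace:
  assumes "1 \<le> j" "j \<le> slots xs"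
  shows "Suc (length (replace_slot j us xs)) = length us + length xs"
  using assms by (induction j us xs rule: replace_slot.induct) auto

lemma mset_numbers_replace:
  assumes "1 \<le> j" "j \<le> slots xs"
  shows "mset (numbers (replace_slot j us xs)) = mset (numbers us) + mset (numbers xs)"
proof -
  have append: "numbers (xs @ ys) = numbers xs @ numbers ys" for xs ys
    by (induction xs rule: numbers.induct) auto
  show ?thesis
    using assms by (induction j us xs rule: replace_slot.induct) (auto simp: append)
qed

section \<open>Codewords are the legal runs\<close>

text \<open>
  Requiring of a \<open>t\<close>, too, that the next slot exists excludes words that go on with \<open>t\<close>
  after all slots are filled. Codewords satisfy it, since each of their runs of \<open>t\<close> is followed by
  a letter that uses a slot further to the right.
\<close>

fun legal :: "it_letter list \<Rightarrow> entry list \<times> nat \<times> nat \<Rightarrow> bool" where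
  "legal [] (xs, i, j) \<longleftrightarrow> slots xs = 0"
| "legal (a # w) (xs, i, j) \<longleftrightarrow> j \<le> slots xs \<and> legal w (it_step a (xs, i, j))"

text \<open>
  Only \<open>f\<close> reduces the number of slots, and only by one. This is what bounds the space.
\<close>

lemma legal_slots_le: "legal w (xs, i, j) \<Longrightarrow> 1 \<le> j \<Longrightarrow> slots xs \<le> length w"
proof (induction w arbitrary: xs i j)
  case (Cons a w)
  show ?case
  proof (cases "a = It_t")
    case True
    then show ?thesis using Cons.IH[of xs i "j + 1"] Cons.prems by auto
  next
    case False
    then show ?thesis
      using Cons.IH[of "replace_slot j (new_entries a i) xs" "Suc i" 1] Cons.prems
        slots_replace[of j xs "new_entries a i"]
      by (auto simp: it_step_insert)
  qed
qed simp

lemma legal_final: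
  assumes "legal w (xs, i, j)" "1 \<le> i" "1 \<le> j" "mset (numbers xs) = mset [1..<i]"
  shows "\<exists>xs' j'. fold it_step w (xs, i, j) = (xs', i + length (filter (\<lambda>a. a \<noteq> It_t) w), j') \<and>
     slots xs' = 0 \<and> mset (numbers xs') = mset [1..<i + length (filter (\<lambda>a. a \<noteq> It_t) w)]"
  using assms
proof (induction w arbitrary: xs i j)
  case (Cons a w)
  show ?case
  proof (cases "a = It_t")
    case True
    then show ?thesis using Cons.IH[of xs i "j + 1"] Cons.prems by auto
  next
    case False
    have "numbers (new_entries a i) = [i]" using False by (cases a) (auto simp: new_entries_def)
    with mset_numbers_replace[of j xs "new_entries a i"] Cons.prems
    have "mset (numbers (replace_slot j (new_entries a i) xs)) = mset [1..<Suc i]"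
      by auto
    then show ?thesis
      using Cons.IH[of "replace_slot j (new_entries a i) xs" "Suc i" 1] Cons.prems False
      by (auto simp: it_step_insert)
  qed
qed auto

lemma map_Num_numbers: "slots xs = 0 \<Longrightarrow> map Num (numbers xs) = xs"
  by (induction xs rule: numbers.induct) auto

lemma numbers_map_Num: "numbers (map Num p) = p"
  by (induction p) auto

lemma legal_represents:
  assumes "legal w ([Slot], 1, 1)"
  shows "\<exists>p. represents w p \<and> distinct p \<and> set p = {1..length (filter (\<lambda>a. a \<noteq> It_t) w)}"
proof -
  from legal_final[OF assms] obtain xs j where xs:
    "fold it_step w ([Slot], 1, 1) = (xs, 1 + length (filter (\<lambda>a. a \<noteq> It_t) w), j)"
    "slots xs = 0" "mset (numbers xs) = mset [1..<1 + length (filter (\<lambda>a. a \<noteq> It_t) w)]"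
    by auto
  have "distinct (numbers xs)" "set (numbers xs) = {1..length (filter (\<lambda>a. a \<noteq> It_t) w)}"
    using mset_eq_imp_distinct_iff[OF xs(3)] mset_eq_setD[OF xs(3)] by auto
  moreover have "represents w (numbers xs)"
    unfolding represents_def xs(1) using map_Num_numbers[OF xs(2)] by simp
  ultimately show ?thesis by blast
qed

definition trailing_t :: "it_letter list \<Rightarrow> nat" where
  "trailing_t u = length (takeWhile (\<lambda>x. x = It_t) (rev u))"

text \<open>
  The left-hand side looks at the list of entries, the right-hand side only counts letters: the number
  of slots is one more than the number of \<open>m\<close> minus the number of \<open>f\<close>, and the next slot is
  one more than the number of trailing \<open>t\<close>s. Here \<open>u\<close> is the part of the word already
  read.
\<close>

lemma legal_iff_counts:
  assumes "int (slots xs) = 1 + int (count_list u It_m) - int (count_list u It_f)"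
    and "j = Suc (trailing_t u)"
  shows "legal v (xs, i, j) \<longleftrightarrow>
    (\<forall>n. length u \<le> n \<and> n < length (u @ v) \<longrightarrow> int (trailing_t (take n (u @ v))) \<le>
       int (count_list (take n (u @ v)) It_m) - int (count_list (take n (u @ v)) It_f)) \<and>
    count_list (u @ v) It_f = count_list (u @ v) It_m + 1"
  using assms
proof (induction v arbitrary: u xs i j)
  case Nil
  then show ?case by auto
next
  case (Cons a v)
  let ?P = "\<lambda>n. int (trailing_t (take n (u @ a # v))) \<le>
       int (count_list (take n (u @ a # v)) It_m) - int (count_list (take n (u @ a # v)) It_f)"
  have P: "?P (length u) \<longleftrightarrow> j \<le> slots xs"
    using Cons.prems by auto
  have all: "(\<forall>n. length u \<le> n \<and> n < length (u @ a # v) \<longrightarrow> ?P n) \<longleftrightarrow>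
     ?P (length u) \<and> (\<forall>n. length (u @ [a]) \<le> n \<and> n < length (u @ a # v) \<longrightarrow> ?P n)"
  proof -
    have "(\<forall>n. k \<le> n \<and> n < m \<longrightarrow> P n) \<longleftrightarrow> P k \<and> (\<forall>n. Suc k \<le> n \<and> n < m \<longrightarrow> P n)"
      if "k < m" for P and k m :: nat
      using that by (metis Suc_leD dual_order.refl not_less_eq_eq le_antisym)
    from this[of "length u" "length (u @ a # v)" ?P] show ?thesis by simp
  qed
  show ?case
  proof (cases "j \<le> slots xs")
    case False
    then show ?thesis using P by auto
  next
    case True
    have "legal v (it_step a (xs, i, j)) \<longleftrightarrow>
      (\<forall>n. length (u @ [a]) \<le> n \<and> n < length ((u @ [a]) @ v) \<longrightarrow> int (trailing_t (take n ((u @ [a]) @ v))) \<le>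
         int (count_list (take n ((u @ [a]) @ v)) It_m) - int (count_list (take n ((u @ [a]) @ v)) It_f)) \<and>
      count_list ((u @ [a]) @ v) It_f = count_list ((u @ [a]) @ v) It_m + 1"
    proof (cases "a = It_t")
      case True
      then show ?thesis
        unfolding True it_step.simps
        using Cons.prems by (intro Cons.IH) (auto simp: trailing_t_def)
    next
      case False
      then show ?thesis
        unfolding it_step_insert[OF False]
        using Cons.prems True slots_replace[of j xs "new_entries a i"]
        by (intro Cons.IH) (cases a; auto simp: trailing_t_def new_entries_def)+
    qed
    then show ?thesis using True P all by simp
  qed
qed

text \<open>
  The inequality on trailing \<open>t\<close>s is demanded by the definition of codewords before letters other
  than \<open>t\<close> only. It extends to each \<open>t\<close> by going backwards from the next such letter, which
  exists because the last letter is an \<open>f\<close>: dropping a \<open>t\<close> lowers the left-hand side and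
  keeps the right-hand side.
\<close>

lemma legal_iff_codeword: "legal w ([Slot], 1, 1) \<longleftrightarrow> w \<in> it_codewords"
proof -
  let ?P = "\<lambda>n. int (trailing_t (take n w)) \<le>
       int (count_list (take n w) It_m) - int (count_list (take n w) It_f)"
  have legal: "legal w ([Slot], 1, 1) \<longleftrightarrow>
      (\<forall>n < length w. ?P n) \<and> count_list w It_f = count_list w It_m + 1"
    using legal_iff_counts[of "[Slot]" "[]" 1 w 1] by (simp add: trailing_t_def)
  have code: "w \<in> it_codewords \<longleftrightarrow> (\<forall>n < length w. w ! n \<noteq> It_t \<longrightarrow> ?P n) \<and> w \<noteq> [] \<and>
      last w = It_f \<and> count_list w It_f = count_list w It_m + 1"
    by (simp add: it_codewords_def trailing_t_def)
  have step: "?P n" if "?P (Suc n)" "n < length w" "w ! n = It_t" for n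
    using that by (simp add: take_Suc_conv_app_nth trailing_t_def)
  show ?thesis
  proof
    assume w: "w \<in> it_codewords"
    have "?P n" if "n < length w" for n
      using that
    proof (induction "length w - n" arbitrary: n rule: less_induct)
      case less
      show ?case
      proof (cases "w ! n = It_t")
        case True
        have "Suc n \<noteq> length w"
          using w code True by (metis diff_Suc_1 it_letter.distinct(20) last_conv_nth)
        then have "Suc n < length w" using less.prems by simp
        then show ?thesis using less.hyps[of "Suc n"] step[OF _ less.prems True] by simp
      next
        case False
        then show ?thesis using w code less.prems by blast
      qed
    qed
    then show "legal w ([Slot], 1, 1)" using w code legal by blast
  next
    assume w: "legal w ([Slot], 1, 1)"
    then have ne: "w \<noteq> []" using legal by auto
    then obtain u a where u: "w = u @ [a]" by (cases w rule: rev_cases) auto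
    have "?P (length u)" using w legal u by auto
    then have "count_list u It_f \<le> count_list u It_m" unfolding u by simp
    moreover have "count_list w It_f = count_list w It_m + 1" using w legal by blast
    ultimately have "a = It_f" unfolding u by (auto split: if_splits)
    then show "w \<in> it_codewords" using w legal code u by auto
  qed
qed

section \<open>Ranks of the marked insertions\<close>

definition insertions :: "(it_letter \<times> bool) list \<Rightarrow> (it_letter \<times> bool) list" where
  "insertions z = filter (\<lambda>x. fst x \<noteq> It_t) z"

text \<open>
  The rank in time of the number \<open>i\<close> among the marked ones, taken from the whole word, so that it
  does not depend on how far the word has been read.
\<close>

definition rank :: "(it_letter \<times> bool) list \<Rightarrow> nat \<Rightarrow> nat" where
  "rank z i = (if snd (insertions z ! (i - 1)) then length (filter snd (take i (insertions z))) else 0)"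

lemma filter_counted: "filter counted z = filter snd (insertions z)"
  by (auto simp: insertions_def counted_def intro: filter_cong)

lemma rank_next:
  assumes "fst x \<noteq> It_t"
  shows "rank (u @ x # v) (Suc (length (insertions u))) =
     (if counted x then Suc (length (filter counted u)) else 0)"
  using assms by (auto simp: rank_def filter_counted insertions_def counted_def nth_append)

text \<open>
  The word is split into the part \<open>u\<close> already read and the rest \<open>v\<close>. The inequality on
  \<open>length xs\<close> says that the number of non-slot entries is at most the number of letters read. As a
  legal rest has at least as many letters as there are slots, the space bound never stops a
  legal run.
\<close>

lemma simulate_iff:
  assumes "z = u @ v" "i = Suc (length (insertions u))" "r = length (filter counted u)" "1 \<le> j"
    and "length xs + length v \<le> slots xs + n" "r \<le> length q"
  shows "simulate q n (tokens (rank z) j xs) r v \<longleftrightarrow>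
    legal (map fst v) (xs, i, j) \<and> length (filter counted z) \<le> length q \<and>
    \<not> order_isomorphic (filter (\<lambda>v. v \<noteq> 0) (map (rank z)
          (numbers (fst (fold it_step (map fst v) (xs, i, j)))))) q"
  using assms
proof (induction v arbitrary: u xs i j r)
  case Nil
  then show ?case by (auto simp: tokens_Item_iff ranks_tokens)
next
  case (Cons x v)
  define r' where "r' = (if counted x then Suc r else r)"
  define val where "val = (if counted x then Suc r else 0)"
  obtain xs' i' j' where st: "it_step (fst x) (xs, i, j) = (xs', i', j')"
    by (cases "it_step (fst x) (xs, i, j)")
  have sim: "simulate q n (tokens (rank z) j xs) r (x # v) \<longleftrightarrow> r' \<le> length q \<and>
      (case edit (fst x) val (tokens (rank z) j xs) of None \<Rightarrow> False
       | Some ts' \<Rightarrow> length ts' \<le> n \<and> simulate q n ts' r' v)"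
    by (simp only: simulate.simps Let_def r'_def val_def)
  have edit: "edit (fst x) val (tokens (rank z) j xs) =
      (if j \<le> slots xs then Some (tokens (rank z) j' xs') else None)"
  proof (cases "fst x = It_t")
    case True
    then show ?thesis using st Cons.prems(4) by (simp add: edit_translate)
  next
    case False
    then have "val = rank z i"
      unfolding Cons.prems(1,2) using rank_next Cons.prems(3) by (simp add: val_def)
    then show ?thesis
      using st False Cons.prems(4) edit_insert[OF False, of j "rank z" i xs] by (simp add: it_step_insert)
  qed
  have r': "r' = length (filter counted (u @ [x]))" using Cons.prems(3) by (simp add: r'_def)
  have r'_le: "length (filter counted z) \<le> length q \<Longrightarrow> r' \<le> length q"
    unfolding r' Cons.prems(1) by (simp split: if_splits)
  have i': "i' = Suc (length (insertions (u @ [x])))" and j': "1 \<le> j'"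
    using st Cons.prems(2) by (cases "fst x"; simp add: insertions_def)+
  show ?case
  proof (cases "j \<le> slots xs")
    case False
    then show ?thesis using sim edit by simp
  next
    case True
    have len: "length xs' + length v \<le> slots xs' + n"
    proof (cases "fst x = It_t")
      case True
      then show ?thesis using st Cons.prems(5) by simp
    next
      case False
      have "length (new_entries (fst x) i) = Suc (slots (new_entries (fst x) i))"
        using False by (cases "fst x") (auto simp: new_entries_def)
      then show ?thesis
        using st False True Cons.prems(4,5) slots_replace[of j xs "new_entries (fst x) i"]
          length_replace[of j xs "new_entries (fst x) i"] by (auto simp: it_step_insert)
    qed
    \<comment> \<open>Each slot will be closed by a letter of its own, hence a legal rest implies that the list fits.\<close>
    have fits: "legal (map fst v) (xs', i', j') \<Longrightarrow> length (tokens (rank z) j' xs') \<le> n"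
      using legal_slots_le[of "map fst v" xs' i' j'] j' len by (simp add: length_tokens)
    have "r' \<le> length q \<Longrightarrow> simulate q n (tokens (rank z) j' xs') r' v \<longleftrightarrow>
      legal (map fst v) (xs', i', j') \<and> length (filter counted z) \<le> length q \<and>
      \<not> order_isomorphic (filter (\<lambda>v. v \<noteq> 0) (map (rank z)
            (numbers (fst (fold it_step (map fst v) (xs', i', j')))))) q"
      using Cons.prems(1) i' r' j' len by (intro Cons.IH[of "u @ [x]"]) auto
    then show ?thesis
      using sim edit True st fits r'_le by auto
  qed
qed

text \<open>
  A word that is not a codeword need not represent a permutation, so nothing is said about
  \<open>p\<close> in this case. For codewords, the rank sequence is compared with the pattern in place of the
  numbers.
\<close>

lemma simulate_iff_codeword:
  assumes "map fst z \<in> it_codewords \<Longrightarrow> represents (map fst z) p"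
  shows "simulate q (length z) [Open] 0 z \<longleftrightarrow>
    map fst z \<in> it_codewords \<and> length (filter counted z) \<le> length q \<and>
    \<not> order_isomorphic (filter (\<lambda>v. v \<noteq> 0) (map (rank z) p)) q"
  using simulate_iff[of z "[]" z 1 0 1 "[Slot]" "length z" q] assms
  by (auto simp: insertions_def represents_def numbers_map_Num legal_iff_codeword[simplified])

lemma length_insertions: "length (insertions z) = length (filter (\<lambda>a. a \<noteq> It_t) (map fst z))"
  by (simp add: insertions_def filter_map comp_def)

lemma rank_neq_0_iff:
  assumes "1 \<le> a" "a \<le> length (insertions z)"
  shows "rank z a \<noteq> 0 \<longleftrightarrow> snd (insertions z ! (a - 1))"
proof -
  have "insertions z ! (a - 1) \<in> set (take a (insertions z))"
    using assms by (auto simp: in_set_conv_nth intro!: exI[of _ "a - 1"])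
  then show ?thesis by (auto simp: rank_def filter_empty_conv)
qed

lemma rank_strict_mono:
  assumes "1 \<le> a" "a < b" "b \<le> length (insertions z)" "rank z a \<noteq> 0" "rank z b \<noteq> 0"
  shows "rank z a < rank z b"
proof -
  have b: "snd (insertions z ! (b - 1))" and a: "snd (insertions z ! (a - 1))"
    using assms rank_neq_0_iff[of b z] rank_neq_0_iff[of a z] by auto
  let ?d = "drop a (take b (insertions z))"
  have "take b (insertions z) = take a (insertions z) @ ?d"
    using assms(2) append_take_drop_id[of a "take b (insertions z)"] by (simp add: min_def)
  then have "length (filter snd (take b (insertions z))) =
      length (filter snd (take a (insertions z))) + length (filter snd ?d)"
    by (metis filter_append length_append)
  moreover have "insertions z ! (b - 1) \<in> set ?d"
    using assms by (auto simp: in_set_conv_nth intro!: exI[of _ "b - 1 - a"])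
  then have "filter snd ?d \<noteq> []" using b by (auto simp: filter_empty_conv)
  ultimately show ?thesis using a b by (simp add: rank_def)
qed

lemma order_isomorphic_map:
  assumes "strict_mono_on (set s) f"
  shows "order_isomorphic (map f s) q \<longleftrightarrow> order_isomorphic s q"
proof -
  have "f (s ! i) < f (s ! j) \<longleftrightarrow> s ! i < s ! j" if "i < length s" "j < length s" for i j
    using strict_mono_on_less[OF assms] that by auto
  then show ?thesis by (auto simp: order_isomorphic_def)
qed

section \<open>Avoidance as a condition on all markings\<close>

definition highlight :: "it_letter list \<Rightarrow> nat set \<Rightarrow> (it_letter \<times> bool) list" where
  "highlight w I = map (\<lambda>i. (w ! i, i \<in> I)) [0..<length w]"

text \<open>
  Entry \<open>a - 1\<close> of this list is the position of the letter that inserts the number \<open>a\<close>.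
\<close>

definition positions :: "it_letter list \<Rightarrow> nat list" where
  "positions w = filter (\<lambda>i. w ! i \<noteq> It_t) [0..<length w]"

lemma map_fst_highlight: "map fst (highlight w I) = w"
  by (rule nth_equalityI) (auto simp: highlight_def)

lemma insertions_highlight: "insertions (highlight w I) = map (\<lambda>i. (w ! i, i \<in> I)) (positions w)"
  by (simp add: insertions_def highlight_def positions_def filter_map comp_def)

lemma length_positions: "length (positions w) = length (filter (\<lambda>a. a \<noteq> It_t) w)"
  using length_insertions[of "highlight w {}"] by (simp add: insertions_highlight map_fst_highlight)

lemma fold_mark_highlight:
  "set is \<subseteq> {..<length w} \<Longrightarrow> fold mark is (highlight w I) = highlight w (I \<union> set is)"
proof (induction "is" arbitrary: I)
  case (Cons i "is")
  have "mark i (highlight w I) = highlight w (insert i I)"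
    using Cons.prems by (intro nth_equalityI) (auto simp: mark_def highlight_def nth_list_update)
  then show ?case using Cons by simp
qed simp

lemma length_filter_counted_highlight: "finite I \<Longrightarrow> length (filter counted (highlight w I)) \<le> card I"
proof -
  assume I: "finite I"
  have "length (filter counted z) \<le> length (filter snd z)" for z
    by (induction z) (auto simp: counted_def)
  then have "length (filter counted (highlight w I)) \<le> length (filter snd (highlight w I))" .
  also have "\<dots> = card (set (filter (\<lambda>i. i \<in> I) [0..<length w]))"
    by (subst distinct_card) (auto simp: highlight_def filter_map comp_def)
  also have "\<dots> \<le> card I" using I by (intro card_mono) auto
  finally show ?thesis .
qed

lemma subseq_set_subset: "subseq s p \<Longrightarrow> set s \<subseteq> set p"
  by (auto elim: list_emb_set)

lemma subseq_filter_set: "subseq s p \<Longrightarrow> distinct p \<Longrightarrow> filter (\<lambda>a. a \<in> set s) p = s"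
proof (induction rule: list_emb.induct)
  case (list_emb_Cons xs ys y)
  then have "y \<notin> set xs" by (auto dest: subseq_set_subset)
  then show ?case using list_emb_Cons by simp
next
  case (list_emb_Cons2 x y xs ys)
  then have "filter (\<lambda>a. a = x \<or> a \<in> set xs) ys = filter (\<lambda>a. a \<in> set xs) ys"
    by (intro filter_cong) auto
  then show ?case using list_emb_Cons2 by simp
qed simp

text \<open>
  Marking the letters that insert the elements of a subsequence \<open>s\<close> singles out exactly
  \<open>s\<close> in \<open>p\<close>, and the rank is strictly increasing on marked numbers. Conversely, the marked
  numbers always form a subsequence. The list \<open>is\<close> may have repetitions, as it does when nested
  loops mark the same letter twice.
\<close>

lemma contains_pattern_iff_highlight:
  assumes p: "distinct p" "set p = {1..length (filter (\<lambda>a. a \<noteq> It_t) w)}"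
  shows "contains_pattern p q \<longleftrightarrow>
    (\<exists>is. length is = length q \<and> set is \<subseteq> {..<length w} \<and>
       order_isomorphic (filter (\<lambda>v. v \<noteq> 0) (map (rank (highlight w (set is))) p)) q)"
proof -
  let ?N = "length (positions w)"
  have set_p: "set p = {1..?N}" using p(2) length_positions by simp
  have rank: "order_isomorphic (filter (\<lambda>v. v \<noteq> 0) (map (rank (highlight w I)) p)) q \<longleftrightarrow>
      order_isomorphic (filter (\<lambda>a. positions w ! (a - 1) \<in> I) p) q" for I
  proof -
    have "filter (\<lambda>v. v \<noteq> 0) (map (rank (highlight w I)) p) =
        map (rank (highlight w I)) (filter (\<lambda>a. rank (highlight w I) a \<noteq> 0) p)"
      by (simp add: filter_map comp_def)
    moreover have "filter (\<lambda>a. rank (highlight w I) a \<noteq> 0) p = filter (\<lambda>a. positions w ! (a - 1) \<in> I) p"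
      using rank_neq_0_iff[of _ "highlight w I"] set_p
      by (intro filter_cong) (auto simp: insertions_highlight Suc_le_eq)
    moreover have "strict_mono_on (set (filter (\<lambda>a. rank (highlight w I) a \<noteq> 0) p)) (rank (highlight w I))"
      using set_p by (intro strict_mono_onI rank_strict_mono) (auto simp: insertions_highlight)
    ultimately show ?thesis by (metis order_isomorphic_map)
  qed
  show ?thesis
    unfolding rank
  proof
    assume "contains_pattern p q"
    then obtain s where s: "subseq s p" "order_isomorphic s q" unfolding contains_pattern_def by blast
    \<comment> \<open>The letters that insert the elements of the subsequence.\<close>
    define ps where "ps = map (\<lambda>a. positions w ! (a - 1)) s"
    have s_p: "set s \<subseteq> {1..?N}" using s(1) set_p subseq_set_subset by metis
    have "positions w ! (a - 1) \<in> set ps \<longleftrightarrow> a \<in> set s" if "a \<in> set p" for a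
    proof -
      have "distinct (positions w)" by (simp add: positions_def)
      then have "a = b" if "b \<in> set s" "positions w ! (a - 1) = positions w ! (b - 1)" for b
        using that s_p \<open>a \<in> set p\<close> set_p nth_eq_iff_index_eq[of "positions w" "a - 1" "b - 1"] by fastforce
      then show ?thesis unfolding ps_def by auto
    qed
    then have "filter (\<lambda>a. positions w ! (a - 1) \<in> set ps) p = filter (\<lambda>a. a \<in> set s) p"
      by (intro filter_cong) auto
    also have "\<dots> = s" using s(1) p(1) by (rule subseq_filter_set)
    finally have "order_isomorphic (filter (\<lambda>a. positions w ! (a - 1) \<in> set ps) p) q" using s(2) by simp
    moreover have "set ps \<subseteq> {..<length w}"
    proof
      fix i assume "i \<in> set ps"
      then obtain a where "a \<in> set s" "i = positions w ! (a - 1)" unfolding ps_def by auto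
      moreover from this have "a - 1 < length (positions w)" using s_p by fastforce
      ultimately have "i \<in> set (positions w)" by auto
      then show "i \<in> {..<length w}" by (auto simp: positions_def)
    qed
    moreover have "length ps = length q" using s(2) by (simp add: ps_def order_isomorphic_def)
    ultimately show "\<exists>is. length is = length q \<and> set is \<subseteq> {..<length w} \<and>
       order_isomorphic (filter (\<lambda>a. positions w ! (a - 1) \<in> set is) p) q" by blast
  next
    assume "\<exists>is. length is = length q \<and> set is \<subseteq> {..<length w} \<and>
       order_isomorphic (filter (\<lambda>a. positions w ! (a - 1) \<in> set is) p) q"
    then show "contains_pattern p q"
      unfolding contains_pattern_def using subseq_filter_left by blast
  qed
qed

lemma funpow_for_all_marks:
  assumes "[] \<notin> L"
  shows "z \<in> (for_all_marks ^^ k) L \<longleftrightarrow>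
    z \<noteq> [] \<and> (\<forall>is. length is = k \<and> set is \<subseteq> {..<length z} \<longrightarrow> fold mark is z \<in> L)"
proof (induction k arbitrary: z)
  case 0
  then show ?case using assms by auto
next
  case (Suc k)
  have len: "length (mark i z) = length z" "mark i z = [] \<longleftrightarrow> z = []" for i by (auto simp: mark_def)
  have "z \<in> (for_all_marks ^^ Suc k) L \<longleftrightarrow> z \<noteq> [] \<and> (\<forall>i < length z. \<forall>is.
      length is = k \<and> set is \<subseteq> {..<length z} \<longrightarrow> fold mark is (mark i z) \<in> L)"
    by (auto simp: for_all_marks_def Suc len)
  also have "\<dots> \<longleftrightarrow> z \<noteq> [] \<and>
      (\<forall>is. length is = Suc k \<and> set is \<subseteq> {..<length z} \<longrightarrow> fold mark is z \<in> L)"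
    by (auto simp: length_Suc_conv) (metis fold_simps(2) insert_subset lessThan_iff list.simps(15) length_Cons)
  finally show ?case .
qed

lemma sweep_decidable_funpow:
  fixes L :: "('a::finite \<times> bool) list set"
  assumes "sweep_decidable L"
  shows "sweep_decidable ((for_all_marks ^^ k) L)"
  using assms by (induction k) (auto intro: sweep_decidable_for_all_marks)

text \<open>
  The nested loops mark precisely the sets of positions that occur in lists of length \<open>length q\<close>.
  For words that are not codewords some marking must be shown to be rejected. All markings are, and one
  exists as the word is not empty.
\<close>

lemma it_avoiders_iff:
  "w \<in> it_avoiders q \<longleftrightarrow> map (\<lambda>a. (a, False)) w \<in>
     (for_all_marks ^^ length q) {z. z \<noteq> [] \<and> simulate q (length z) [Open] 0 z}"
proof -
  let ?L = "{z. z \<noteq> [] \<and> simulate q (length z) [Open] 0 z}"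
  have hl: "map (\<lambda>a. (a, False)) w = highlight w {}"
    by (rule nth_equalityI) (auto simp: highlight_def)
  have len: "length (highlight w I) = length w" for I by (simp add: highlight_def)
  have ne: "highlight w I = [] \<longleftrightarrow> w = []" for I by (simp add: highlight_def)
  have fold: "fold mark is (highlight w {}) = highlight w (set is)" if "set is \<subseteq> {..<length w}" for "is"
    using fold_mark_highlight[OF that, of "{}"] by simp
  have L: "[] \<notin> ?L" by simp
  have "map (\<lambda>a. (a, False)) w \<in> (for_all_marks ^^ length q) ?L \<longleftrightarrow>
      w \<noteq> [] \<and> (\<forall>is. length is = length q \<and> set is \<subseteq> {..<length w} \<longrightarrow>
         fold mark is (highlight w {}) \<in> ?L)"
    unfolding hl funpow_for_all_marks[OF L] len ne ..
  also have "\<dots> \<longleftrightarrow>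
      w \<noteq> [] \<and> (\<forall>is. length is = length q \<and> set is \<subseteq> {..<length w} \<longrightarrow>
         simulate q (length w) [Open] 0 (highlight w (set is)))"
    by (auto simp: fold len ne)
  also have "\<dots> \<longleftrightarrow> w \<in> it_avoiders q"
  proof (cases "w \<in> it_codewords")
    case False
    have "\<exists>is :: nat list. length is = length q \<and> set is \<subseteq> {..<length w}" if "w \<noteq> []"
      using that by (intro exI[of _ "replicate (length q) 0"]) auto
    moreover have "\<not> simulate q (length w) [Open] 0 (highlight w I)" for I
      using simulate_iff_codeword[of "highlight w I" _ q] False by (simp add: map_fst_highlight len)
    ultimately show ?thesis using False by (auto simp: it_avoiders_def)
  next
    case True
    then obtain p where p: "represents w p" "distinct p"
      "set p = {1..length (filter (\<lambda>a. a \<noteq> It_t) w)}"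
      using legal_represents legal_iff_codeword by blast
    have unique: "p' = p" if "represents w p'" for p'
      using that p(1) unfolding represents_def by (metis numbers_map_Num)
    have "simulate q (length w) [Open] 0 (highlight w (set is)) \<longleftrightarrow>
        \<not> order_isomorphic (filter (\<lambda>v. v \<noteq> 0) (map (rank (highlight w (set is))) p)) q"
      if "length is = length q" for "is"
    proof -
      have "length (filter counted (highlight w (set is))) \<le> length q"
        using length_filter_counted_highlight[of "set is" w] card_length[of "is"] that by simp
      then show ?thesis
        using simulate_iff_codeword[of "highlight w (set is)" p q] True p(1)
        by (simp add: map_fst_highlight len)
    qed
    moreover have "w \<noteq> []" using True by (auto simp: it_codewords_def)
    moreover have "w \<in> it_avoiders q \<longleftrightarrow> \<not> contains_pattern p q"
      using True p(1) unique unfolding it_avoiders_def by blast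
    ultimately show ?thesis
      unfolding contains_pattern_iff_highlight[OF p(2,3)] by blast
  qed
  finally show ?thesis by blast
qed

theorem theorem8:
  fixes q :: "real list"
  assumes "distinct q"
  shows "\<exists>M :: (nat, nat, it_letter) lba.
           is_lba M \<and> lba_language M = it_avoiders q \<and> polynomial_time_lba M"
proof -
  have "it_avoiders q = {w. map (\<lambda>a. (a, False)) w \<in>
     (for_all_marks ^^ length q) {z. z \<noteq> [] \<and> simulate q (length z) [Open] 0 z}}"
    using it_avoiders_iff by blast
  moreover have "sweep_decidable \<dots>"
    by (intro sweep_decidable_vimage sweep_decidable_funpow sweep_decidable_simulate)
  ultimately show ?thesis using lba_if_sweep_decidable by metis
qed

end
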